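(* Let $L\in\{1,\infty\}$, let $E$ be a rearrangement-invariant quasi-Banach function space on $(0,L)$ with quasi-norm $\rho_E$, lower Boyd index $p_E$ and upper Boyd index $q_E$, and let $0<\Theta<\infty$ and $0<r<p_E$ (with $r<\infty$). Assume additionally that $$\frac1\Theta+\frac1{q_E}>\frac1r\quad\text{if } q_E<\infty,\qquad\text{or}\qquad \frac1\Theta\ge\frac1r\quad\text{if } q_E=\infty.$$ Then $(\cdot,\cdot)_{\Theta,r;E}$ is an exact interpolation functor, and if $(X_0,X_1)$ is a compatible couple of quasi-normed spaces, then $(X_0,X_1)_{\Theta,r;E}$ is also a quasi-normed space. Moreover, if the spaces $X_0$, $X_1$ and $E$ are normed, then $(X_0,X_1)_{\Theta,r;E}$ is also a normed space.
   Context: Conventions: $1/\infty=0$. $\mathfrak M(0,L)$ is the set of complex-valued Lebesgue measurable, a.e. finite functions on $(0,L)$, with a.e. equal functions identified. The non-increasing rearrangement of $f$ is $f^*(t)=\inf\{\lambda>0:\ |\{x\in(0,L):|f(x)|>\lambda\}|\le t\}$, $t>0$. A quasi-norm is a map satisfying the norm axioms except that the triangle inequality is replaced by $\|x+y\|\le C(\|x\|+\|y\|)$ with a constant $C\ge1$ (the quasi-triangle constant); the space is normed if one can take $C=1$. Rearrangement-invariant (r.i.) quasi-Banach function space on $(0,L)$: a quasi-Banach space $E\subset\mathfrak M(0,L)$ for which there is $\rho_E:\mathfrak M(0,L)\to[0,\infty]$ such that (P1) $\rho_E$ is a quasi-norm (possibly taking the value $\infty$); (P2) $|g|\le|f|$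 a.e. implies $\rho_E(g)\le\rho_E(f)$; (P3) $0\le f_n\nearrow f$ a.e. implies $\rho_E(f_n)\nearrow\rho_E(f)$; (P4) $\rho_E(\chi_\omega)<\infty$ for all measurable $\omega\subset(0,L)$ of finite measure; and $\|f\|_E=\rho_E(f^* )$ for all $f\in E$, where $E=\{f\in\mathfrak M(0,L):\rho_E(f^* )<\infty\}$. "$E$ is normed" means that $\rho_E$ satisfies the triangle inequality with constant $1$. Boyd indices: for $0<a<\infty$ let $(D_af)(t)=f(at)\chi_{(0,L)}(at)$, $0<t<L$, and let $\|D_a\|$ be its operator norm on $E$. Then $p_E=\sup\{p>0:\exists c>0\ \forall\,0<a<1,\ \|D_a\|\le c\,a^{-1/p}\}$ and $q_E=\inf\{q>0:\exists c>0\ \forall\,a\ge1,\ \|D_a\|\le c\,a^{-1/q}\}$ (with $\inf\emptyset=\infty$). A compatible couple $(X_0,X_1)$ consists of two quasi-normed spaces continuously embedded in a common Hausdorff topological vector space. $X_0\cap X_1$ has quasi-norm $\max\{\|f\|_{X_0},\|f\|_{X_1}\}$ and $X_0+X_1$ has quasi-norm $\inf\{\|f_0\|_{X_0}+\|f_1\|_{X_1}:f=f_0+f_1,\ f_i\in X_i\}$. Peetre's $K$-functional is $K(t,x;X_0,X_1)=\inf\{\|x_0\|_{X_0}+t\|x_1\|_{X_1}:x=x_0+x_1,\ x_i\in X_i\}$, $t>0$, $x\in X_0+X_1$. For $0<\Theta,r<\infty$, the space $(X_0,X_1)_{\Theta,r;E}$ consists of all $x\in X_0+X_1$ with $\|x\|_{(X_0,X_1)_{\Theta,r;E}}:=\rho_E\big(t^{-1/r}K(t^{1/\Theta},x;X_0,X_1)\big)<\infty$,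 where the argument of $\rho_E$ is regarded as a function of $t\in(0,L)$. That $(\cdot,\cdot)_{\Theta,r;E}$ is an exact interpolation functor means: for every compatible couple $(X_0,X_1)$ of quasi-normed spaces, writing $X=(X_0,X_1)_{\Theta,r;E}$, one has continuous embeddings $X_0\cap X_1\hookrightarrow X\hookrightarrow X_0+X_1$, and every linear operator $T:X_0+X_1\to X_0+X_1$ whose restrictions to $X_i$ are bounded from $X_i$ to $X_i$ ($i=0,1$) is bounded from $X$ to $X$ with $\|T\|_{X\to X}\le\max\{\|T\|_{X_0\to X_0},\|T\|_{X_1\to X_1}\}$. *)

theory Defs
  imports "HOL-Analysis.Analysis"
begin

section \<open>Rearrangement-invariant quasi-Banach function spaces on $(0,L)$\<close>

text \<open>
  A function on \<open>(0,L)\<close> is a total function on the reals whose values outside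
  \<open>einterval 0 L\<close> never matter; instead of passing to classes modulo a.e. equality, all axioms
  are stated up to a.e. equality on \<open>(0,L)\<close>. A quasi-norm possibly taking the value \<open>\<infinity>\<close> is a
  functional with values in \<^typ>\<open>ennreal\<close>, for which \<open>0 * \<infinity> = 0\<close>.
\<close>

abbreviation leb :: "ereal \<Rightarrow> real measure" where
  "leb L \<equiv> lebesgue_on (einterval 0 L)"

definition meas_funs :: "ereal \<Rightarrow> (real \<Rightarrow> complex) set" where
  "meas_funs L = borel_measurable (leb L)"

definition ext_triangle_const ::
  "ereal \<Rightarrow> ((real \<Rightarrow> complex) \<Rightarrow> ennreal) \<Rightarrow> real \<Rightarrow> bool" where
  "ext_triangle_const L N C \<longleftrightarrow>
     (\<forall>f\<in>meas_funs L. \<forall>g\<in>meas_funs L. N (\<lambda>x. f x + g x) \<le> ennreal C * (N f + N g))"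

definition ext_quasi_norm :: "ereal \<Rightarrow> ((real \<Rightarrow> complex) \<Rightarrow> ennreal) \<Rightarrow> bool" where
  "ext_quasi_norm L N \<longleftrightarrow>
     (\<forall>f\<in>meas_funs L. N f = 0 \<longleftrightarrow> (AE x in leb L. f x = 0)) \<and>
     (\<forall>f\<in>meas_funs L. \<forall>c. N (\<lambda>x. c * f x) = ennreal (cmod c) * N f) \<and>
     (\<exists>C\<ge>1. ext_triangle_const L N C)"

definition rearrangement :: "ereal \<Rightarrow> (real \<Rightarrow> complex) \<Rightarrow> real \<Rightarrow> ennreal" where
  "rearrangement L f t =
     Inf {ennreal s |s. s > 0 \<and>
            emeasure (leb L) {x \<in> einterval 0 L. cmod (f x) > s} \<le> ennreal t}"

text \<open>
  The value of \<open>\<rho>\<close> at the rearrangement of \<open>f\<close>. The rearrangement may be infinite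
  (for \<open>f x = x\<close> on \<open>(0,\<infinity>)\<close>, say); then it is not an a.e. finite function, and the
  value is \<open>\<infinity>\<close>.
\<close>

definition ri_norm ::
  "ereal \<Rightarrow> ((real \<Rightarrow> complex) \<Rightarrow> ennreal) \<Rightarrow> (real \<Rightarrow> complex) \<Rightarrow> ennreal" where
  "ri_norm L \<rho> f =
     (if AE t in leb L. rearrangement L f t < \<infinity>
      then \<rho> (\<lambda>t. complex_of_real (enn2real (rearrangement L f t))) else \<infinity>)"

definition ri_space :: "ereal \<Rightarrow> ((real \<Rightarrow> complex) \<Rightarrow> ennreal) \<Rightarrow> (real \<Rightarrow> complex) set" where
  "ri_space L \<rho> = {f \<in> meas_funs L. ri_norm L \<rho> f < \<infinity>}"

definition ri_complete :: "ereal \<Rightarrow> ((real \<Rightarrow> complex) \<Rightarrow> ennreal) \<Rightarrow> bool" where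
  "ri_complete L \<rho> \<longleftrightarrow>
     (\<forall>f :: nat \<Rightarrow> real \<Rightarrow> complex.
        (\<forall>n. f n \<in> ri_space L \<rho>) \<and>
        (\<forall>e>0. \<exists>N. \<forall>m\<ge>N. \<forall>n\<ge>N. ri_norm L \<rho> (\<lambda>x. f m x - f n x) < ennreal e)
        \<longrightarrow> (\<exists>g\<in>ri_space L \<rho>. (\<lambda>n. ri_norm L \<rho> (\<lambda>x. f n x - g x)) \<longlonglongrightarrow> 0))"

text \<open>
  The condition \<open>ext_quasi_norm L (ri_norm L \<rho>)\<close>, together with \<open>ri_complete\<close>, says that
  \<open>E\<close> is a quasi-Banach space: it makes \<open>E\<close> a linear space on which \<open>ri_norm L \<rho>\<close> is a (finite)
  quasi-norm. It does not follow from the other conditions, since \<open>\<rho>\<close> itself need not be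
  rearrangement invariant.
\<close>

definition ri_quasi_Banach :: "ereal \<Rightarrow> ((real \<Rightarrow> complex) \<Rightarrow> ennreal) \<Rightarrow> bool" where
  "ri_quasi_Banach L \<rho> \<longleftrightarrow>
     ext_quasi_norm L \<rho> \<and>
     (\<forall>f\<in>meas_funs L. \<forall>g\<in>meas_funs L.
        (AE x in leb L. cmod (g x) \<le> cmod (f x)) \<longrightarrow> \<rho> g \<le> \<rho> f) \<and>
     (\<forall>(f :: nat \<Rightarrow> real \<Rightarrow> real) g.
        (\<forall>n. f n \<in> borel_measurable (leb L)) \<and> g \<in> borel_measurable (leb L) \<and>
        (AE x in leb L. (\<forall>n. 0 \<le> f n x) \<and> incseq (\<lambda>n. f n x) \<and> (\<lambda>n. f n x) \<longlonglongrightarrow> g x)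
        \<longrightarrow> incseq (\<lambda>n. \<rho> (\<lambda>x. complex_of_real (f n x))) \<and>
            (\<lambda>n. \<rho> (\<lambda>x. complex_of_real (f n x))) \<longlonglongrightarrow> \<rho> (\<lambda>x. complex_of_real (g x))) \<and>
     (\<forall>\<omega>. \<omega> \<in> sets lebesgue \<and> \<omega> \<subseteq> einterval 0 L \<and> emeasure lebesgue \<omega> < \<infinity>
        \<longrightarrow> \<rho> (indicator \<omega>) < \<infinity>) \<and>
     ext_quasi_norm L (ri_norm L \<rho>) \<and>
     ri_complete L \<rho>"

section \<open>Boyd indices\<close>

definition dilation :: "ereal \<Rightarrow> real \<Rightarrow> (real \<Rightarrow> complex) \<Rightarrow> real \<Rightarrow> complex" where
  "dilation L a f = (\<lambda>t. if a * t \<in> einterval 0 L then f (a * t) else 0)"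

definition dilation_norm :: "ereal \<Rightarrow> ((real \<Rightarrow> complex) \<Rightarrow> ennreal) \<Rightarrow> real \<Rightarrow> ennreal" where
  "dilation_norm L \<rho> a =
     Inf {C. \<forall>f\<in>ri_space L \<rho>. ri_norm L \<rho> (dilation L a f) \<le> C * ri_norm L \<rho> f}"

definition lower_Boyd :: "ereal \<Rightarrow> ((real \<Rightarrow> complex) \<Rightarrow> ennreal) \<Rightarrow> ennreal" where
  "lower_Boyd L \<rho> =
     Sup {ennreal p |p. p > 0 \<and>
            (\<exists>c>0. \<forall>a. 0 < a \<and> a < 1 \<longrightarrow> dilation_norm L \<rho> a \<le> ennreal (c * a powr (- 1 / p)))}"

definition upper_Boyd :: "ereal \<Rightarrow> ((real \<Rightarrow> complex) \<Rightarrow> ennreal) \<Rightarrow> ennreal" where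
  "upper_Boyd L \<rho> =
     Inf {ennreal q |q. q > 0 \<and>
            (\<exists>c>0. \<forall>a\<ge>1. dilation_norm L \<rho> a \<le> ennreal (c * a powr (- 1 / q)))}"

section \<open>Quasi-normed spaces and compatible couples\<close>

text \<open>
  Spaces of a couple are linear subspaces of an ambient vector space, which is a whole type \<open>'v\<close>.
  Leaving the scalars as an arbitrary \<^class>\<open>real_normed_field\<close> treats real and complex spaces
  simultaneously.
\<close>

record 'v qn_space =
  vecs :: "'v set"
  qnorm :: "'v \<Rightarrow> real"

definition quasi_normed_const ::
  "('k::real_normed_field \<Rightarrow> 'v::ab_group_add \<Rightarrow> 'v) \<Rightarrow> real \<Rightarrow> 'v qn_space \<Rightarrow> bool" where
  "quasi_normed_const smul C X \<longleftrightarrow>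
     module.subspace smul (vecs X) \<and>
     (\<forall>x\<in>vecs X. 0 \<le> qnorm X x) \<and>
     (\<forall>x\<in>vecs X. qnorm X x = 0 \<longleftrightarrow> x = 0) \<and>
     (\<forall>c. \<forall>x\<in>vecs X. qnorm X (smul c x) = norm c * qnorm X x) \<and>
     (\<forall>x\<in>vecs X. \<forall>y\<in>vecs X. qnorm X (x + y) \<le> C * (qnorm X x + qnorm X y))"

definition quasi_normed_space ::
  "('k::real_normed_field \<Rightarrow> 'v::ab_group_add \<Rightarrow> 'v) \<Rightarrow> 'v qn_space \<Rightarrow> bool" where
  "quasi_normed_space smul X \<longleftrightarrow> (\<exists>C\<ge>1. quasi_normed_const smul C X)"

definition normed_space ::
  "('k::real_normed_field \<Rightarrow> 'v::ab_group_add \<Rightarrow> 'v) \<Rightarrow> 'v qn_space \<Rightarrow> bool" where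
  "normed_space smul X \<longleftrightarrow> quasi_normed_const smul 1 X"

text \<open>Balls of a quasi-norm need not be open, but they form a base of neighbourhoods.\<close>

definition qn_topology :: "'v::ab_group_add qn_space \<Rightarrow> 'v topology" where
  "qn_topology X = topology (\<lambda>U. U \<subseteq> vecs X \<and>
     (\<forall>x\<in>U. \<exists>e>0. \<forall>y\<in>vecs X. qnorm X (y - x) < e \<longrightarrow> y \<in> U))"

lemma openin_qn_topology:
  "openin (qn_topology X) U \<longleftrightarrow> U \<subseteq> vecs X \<and>
     (\<forall>x\<in>U. \<exists>e>0. \<forall>y\<in>vecs X. qnorm X (y - x) < e \<longrightarrow> y \<in> U)"
proof -
  have "istopology (\<lambda>U. U \<subseteq> vecs X \<and>
     (\<forall>x\<in>U. \<exists>e>0. \<forall>y\<in>vecs X. qnorm X (y - x) < e \<longrightarrow> y \<in> U))"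
    unfolding istopology_def
  proof (intro conjI allI impI ballI; (elim conjE)?)
    fix S T x
    assume S: "\<forall>x\<in>S. \<exists>e>0. \<forall>y\<in>vecs X. qnorm X (y - x) < e \<longrightarrow> y \<in> S"
      and T: "\<forall>x\<in>T. \<exists>e>0. \<forall>y\<in>vecs X. qnorm X (y - x) < e \<longrightarrow> y \<in> T"
      and x: "x \<in> S \<inter> T"
    from S x obtain d where d: "d > 0" "\<forall>y\<in>vecs X. qnorm X (y - x) < d \<longrightarrow> y \<in> S" by blast
    from T x obtain e where e: "e > 0" "\<forall>y\<in>vecs X. qnorm X (y - x) < e \<longrightarrow> y \<in> T" by blast
    from d e show "\<exists>e>0. \<forall>y\<in>vecs X. qnorm X (y - x) < e \<longrightarrow> y \<in> S \<inter> T"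
      by (intro exI[of _ "min d e"]) auto
  next
    fix \<K> x
    assume "\<forall>K\<in>\<K>. K \<subseteq> vecs X \<and>
        (\<forall>x\<in>K. \<exists>e>0. \<forall>y\<in>vecs X. qnorm X (y - x) < e \<longrightarrow> y \<in> K)" and "x \<in> \<Union>\<K>"
    then show "\<exists>e>0. \<forall>y\<in>vecs X. qnorm X (y - x) < e \<longrightarrow> y \<in> \<Union>\<K>"
      by (meson UnionE UnionI)
  qed blast+
  then show ?thesis
    unfolding qn_topology_def by (simp add: topology_inverse')
qed

lemma topspace_qn_topology: "topspace (qn_topology X) = vecs X"
proof
  show "topspace (qn_topology X) \<subseteq> vecs X"
    using openin_topspace[of "qn_topology X"] unfolding openin_qn_topology by blast
  have "openin (qn_topology X) (vecs X)"
    unfolding openin_qn_topology using zero_less_one by blast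
  then show "vecs X \<subseteq> topspace (qn_topology X)"
    by (rule openin_subset)
qed

definition continuously_embedded :: "'v topology \<Rightarrow> 'v topology \<Rightarrow> bool" where
  "continuously_embedded S T \<longleftrightarrow> topspace S \<subseteq> topspace T \<and> continuous_map S T (\<lambda>x. x)"

definition Hausdorff_tvs ::
  "('k::real_normed_field \<Rightarrow> 'v::ab_group_add \<Rightarrow> 'v) \<Rightarrow> 'v topology \<Rightarrow> bool" where
  "Hausdorff_tvs smul T \<longleftrightarrow>
     vector_space smul \<and> topspace T = UNIV \<and> Hausdorff_space T \<and>
     continuous_map (prod_topology T T) T (\<lambda>(x, y). x + y) \<and>
     continuous_map (prod_topology euclidean T) T (\<lambda>(c, x). smul c x)"

definition compatible_couple ::
  "('k::real_normed_field \<Rightarrow> 'v::ab_group_add \<Rightarrow> 'v) \<Rightarrow> 'v qn_space \<Rightarrow> 'v qn_space \<Rightarrow> bool" where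
  "compatible_couple smul X0 X1 \<longleftrightarrow>
     quasi_normed_space smul X0 \<and> quasi_normed_space smul X1 \<and>
     (\<exists>T. Hausdorff_tvs smul T \<and>
        continuously_embedded (qn_topology X0) T \<and> continuously_embedded (qn_topology X1) T)"

definition couple_inter :: "'v qn_space \<Rightarrow> 'v qn_space \<Rightarrow> 'v qn_space" where
  "couple_inter X0 X1 =
     \<lparr>vecs = vecs X0 \<inter> vecs X1, qnorm = (\<lambda>x. max (qnorm X0 x) (qnorm X1 x))\<rparr>"

definition couple_sum ::
  "'v::ab_group_add qn_space \<Rightarrow> 'v qn_space \<Rightarrow> 'v qn_space" where
  "couple_sum X0 X1 =
     \<lparr>vecs = {x0 + x1 |x0 x1. x0 \<in> vecs X0 \<and> x1 \<in> vecs X1},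
      qnorm = (\<lambda>x. Inf {qnorm X0 x0 + qnorm X1 x1 |x0 x1.
                          x0 \<in> vecs X0 \<and> x1 \<in> vecs X1 \<and> x = x0 + x1})\<rparr>"

definition K_functional ::
  "real \<Rightarrow> 'v \<Rightarrow> 'v::ab_group_add qn_space \<Rightarrow> 'v qn_space \<Rightarrow> real" where
  "K_functional t x X0 X1 =
     Inf {qnorm X0 x0 + t * qnorm X1 x1 |x0 x1.
            x0 \<in> vecs X0 \<and> x1 \<in> vecs X1 \<and> x = x0 + x1}"

section \<open>The interpolation method\<close>

definition interp_value ::
  "real \<Rightarrow> real \<Rightarrow> ((real \<Rightarrow> complex) \<Rightarrow> ennreal) \<Rightarrow>
     'v::ab_group_add qn_space \<Rightarrow> 'v qn_space \<Rightarrow> 'v \<Rightarrow> ennreal" where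
  "interp_value \<Theta> r \<rho> X0 X1 x =
     \<rho> (\<lambda>t. complex_of_real (t powr (- 1 / r) * K_functional (t powr (1 / \<Theta>)) x X0 X1))"

definition interp_space ::
  "real \<Rightarrow> real \<Rightarrow> ((real \<Rightarrow> complex) \<Rightarrow> ennreal) \<Rightarrow>
     'v::ab_group_add qn_space \<Rightarrow> 'v qn_space \<Rightarrow> 'v qn_space" where
  "interp_space \<Theta> r \<rho> X0 X1 =
     \<lparr>vecs = {x \<in> vecs (couple_sum X0 X1). interp_value \<Theta> r \<rho> X0 X1 x < \<infinity>},
      qnorm = (\<lambda>x. enn2real (interp_value \<Theta> r \<rho> X0 X1 x))\<rparr>"

definition linear_op_on ::
  "('k \<Rightarrow> 'v::ab_group_add \<Rightarrow> 'v) \<Rightarrow> 'v set \<Rightarrow> ('v \<Rightarrow> 'v) \<Rightarrow> bool" where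
  "linear_op_on smul S T \<longleftrightarrow>
     T ` S \<subseteq> S \<and> (\<forall>x\<in>S. \<forall>y\<in>S. T (x + y) = T x + T y) \<and>
     (\<forall>c. \<forall>x\<in>S. T (smul c x) = smul c (T x))"

definition bounded_op :: "'v qn_space \<Rightarrow> ('v \<Rightarrow> 'v) \<Rightarrow> bool" where
  "bounded_op X T \<longleftrightarrow> T ` vecs X \<subseteq> vecs X \<and>
     (\<exists>C. \<forall>x\<in>vecs X. qnorm X (T x) \<le> C * qnorm X x)"

definition op_norm :: "'v qn_space \<Rightarrow> ('v \<Rightarrow> 'v) \<Rightarrow> real" where
  "op_norm X T = Inf {C. 0 \<le> C \<and> (\<forall>x\<in>vecs X. qnorm X (T x) \<le> C * qnorm X x)}"

definition exact_interpolation_functor ::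
  "('k::real_normed_field \<Rightarrow> 'v::ab_group_add \<Rightarrow> 'v) \<Rightarrow>
     ('v qn_space \<Rightarrow> 'v qn_space \<Rightarrow> 'v qn_space) \<Rightarrow> bool" where
  "exact_interpolation_functor smul F \<longleftrightarrow>
     (\<forall>X0 X1. compatible_couple smul X0 X1 \<longrightarrow>
        continuously_embedded (qn_topology (couple_inter X0 X1)) (qn_topology (F X0 X1)) \<and>
        continuously_embedded (qn_topology (F X0 X1)) (qn_topology (couple_sum X0 X1)) \<and>
        (\<forall>T. linear_op_on smul (vecs (couple_sum X0 X1)) T \<and>
             bounded_op X0 T \<and> bounded_op X1 T \<longrightarrow>
             bounded_op (F X0 X1) T \<and>
             op_norm (F X0 X1) T \<le> max (op_norm X0 T) (op_norm X1 T)))"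

end

theory Submission
  imports Defs
begin

text \<open>
  Everything reduces to the weight \<open>\<phi> t = t powr (- 1 / r) * min 1 (t powr (1 / \<Theta>))\<close>. The
  K-functional satisfies
  \<open>min 1 t * K 1 x \<le> K t x\<close> on the sum and \<open>K t x \<le> min 1 t * max (qnorm X0 x) (qnorm X1 x)\<close> on the
  intersection, so both embeddings follow once \<open>\<rho> \<phi>\<close> is finite and non-zero. Finiteness is where
  the Boyd indices enter: at infinity \<open>\<phi>\<close> is the power \<open>- 1 / r\<close>, with \<open>r\<close> below the lower index,
  and near 0 it is the power \<open>1 / \<Theta> - 1 / r\<close>, which is bounded or has a singularity controlled
  by the upper index. In both cases suitable continuous truncations are self-similar under a
  dilation, which bounds their quasi-norms uniformly without summing a series in a quasi-normed
  space, and the Fatou property passes to the limit. Bounds on the K-functional give the remaining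
  claims; the Hausdorff ambient space is needed for \<open>K 1 x = 0\<close> to imply \<open>x = 0\<close>.
\<close>

section \<open>Rearrangements\<close>

lemma in_einterval_0_iff: "x \<in> einterval 0 L \<longleftrightarrow> 0 < x \<and> ereal x < L"
  by (simp add: einterval_def zero_ereal_def)

lemma space_leb: "space (leb L) = einterval 0 L"
  by (simp add: space_restrict_space)

section \<open>Measurability of monotone functions on the interval\<close>

lemma measurable_leb:
  fixes f :: "real \<Rightarrow> 'b::topological_space"
  assumes "f \<in> borel_measurable (restrict_space borel (einterval 0 L))"
  shows "f \<in> borel_measurable (leb L)"
proof (rule measurableI)
  fix A :: "'b set" assume "A \<in> sets borel"
  then have "f -` A \<inter> einterval 0 L \<in> sets (restrict_space borel (einterval 0 L))"
    using measurable_sets[OF assms] by (simp add: space_restrict_space)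
  then show "f -` A \<inter> space (leb L) \<in> sets (leb L)"
    by (auto simp: space_leb sets_restrict_space intro: sets_completionI_sets)
qed auto

lemma mono_on_measurable_leb:
  fixes f :: "real \<Rightarrow> real"
  assumes "mono_on {0<..} f"
  shows "f \<in> borel_measurable (leb L)"
proof (rule measurable_leb, rule borel_measurable_mono_on_fnc)
  show "mono_on (einterval 0 L) f"
    using assms by (rule mono_on_subset) (auto simp: in_einterval_0_iff)
qed

text \<open>Strict sublevel sets are intervals, hence Borel. The codomain is general so that this
  serves both real functions and \<open>rearrangement\<close>, whose values are in
  \<open>ennreal\<close>.\<close>

lemma antimono_measurable_leb:
  fixes f :: "real \<Rightarrow> 'b::{linorder_topology, second_countable_topology}"
  assumes "\<And>s t. 0 < s \<Longrightarrow> s \<le> t \<Longrightarrow> f t \<le> f s"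
  shows "f \<in> borel_measurable (leb L)"
proof (rule borel_measurableI_less)
  fix y
  have "is_interval {x \<in> einterval 0 L. f x < y}"
    unfolding is_interval_1
  proof (intro ballI allI impI)
    fix a b x assume ab: "a \<in> {x \<in> einterval 0 L. f x < y}" "b \<in> {x \<in> einterval 0 L. f x < y}"
      and x: "a \<le> x \<and> x \<le> b"
    have "f x \<le> f a" using ab x by (intro assms) (auto simp: in_einterval_0_iff)
    moreover have "ereal x < L"
      using ab x by (auto simp: in_einterval_0_iff intro: le_less_trans[of _ "ereal b"])
    ultimately show "x \<in> {x \<in> einterval 0 L. f x < y}"
      using ab x by (auto simp: in_einterval_0_iff)
  qed
  then have "{x \<in> einterval 0 L. f x < y} \<in> sets lebesgue"
    by (intro sets_completionI_sets) (simp add: real_interval_borel_measurable)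
  then show "{x \<in> space (leb L). f x < y} \<in> sets (leb L)"
    by (auto simp: space_leb sets_restrict_space)
qed

section \<open>Monotonicity of rearrangements and explicit estimates\<close>

lemma superlevel_sets:
  assumes "f \<in> meas_funs L"
  shows "{x \<in> einterval 0 L. cmod (f x) > s} \<in> sets (leb L)"
proof -
  have "(\<lambda>x. cmod (f x)) \<in> borel_measurable (leb L)"
    using assms by (simp add: meas_funs_def)
  from borel_measurable_less[OF borel_measurable_const[of s] this] show ?thesis
    by (simp add: space_leb)
qed

lemma rearrangement_antimono: "s \<le> t \<Longrightarrow> rearrangement L f t \<le> rearrangement L f s"
  unfolding rearrangement_def
proof (rule Inf_superset_mono, safe)
  fix u assume "s \<le> t" "u > 0" "emeasure (leb L) {x \<in> einterval 0 L. cmod (f x) > u} \<le> ennreal s"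
  moreover from this have "emeasure (leb L) {x \<in> einterval 0 L. cmod (f x) > u} \<le> ennreal t"
    by (meson ennreal_leI order_trans)
  ultimately show "\<exists>v. ennreal u = ennreal v \<and> v > 0 \<and>
      emeasure (leb L) {x \<in> einterval 0 L. cmod (f x) > v} \<le> ennreal t"
    by (intro exI[of _ u]) simp
qed

lemma rearrangement_mono:
  assumes "f \<in> meas_funs L" "\<And>x. x \<in> einterval 0 L \<Longrightarrow> cmod (g x) \<le> cmod (f x)"
  shows "rearrangement L g t \<le> rearrangement L f t"
proof -
  have le: "emeasure (leb L) {x \<in> einterval 0 L. cmod (g x) > s}
      \<le> emeasure (leb L) {x \<in> einterval 0 L. cmod (f x) > s}" for s
    using assms by (intro emeasure_mono superlevel_sets subsetI) (auto intro: less_le_trans)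
  have "emeasure (leb L) {x \<in> einterval 0 L. cmod (g x) > s} \<le> ennreal t"
    if "emeasure (leb L) {x \<in> einterval 0 L. cmod (f x) > s} \<le> ennreal t" for s
    using le that by (rule order_trans)
  then show ?thesis
    unfolding rearrangement_def by (intro Inf_superset_mono) blast
qed

lemma emeasure_leb_Ioc:
  assumes "t \<in> einterval 0 L"
  shows "emeasure (leb L) {0<..t} = ennreal t" "{0<..t} \<in> sets (leb L)"
proof -
  have "ereal x < L" if "x \<le> t" for x
    using assms that by (auto simp: in_einterval_0_iff intro: le_less_trans[of _ "ereal t"])
  then have sub: "{0<..t} \<subseteq> einterval 0 L"
    by (auto simp: in_einterval_0_iff)
  then show "emeasure (leb L) {0<..t} = ennreal t"
    using assms by (subst emeasure_restrict_space) (auto simp: in_einterval_0_iff)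
  show "{0<..t} \<in> sets (leb L)"
    using sub by (subst sets_restrict_space_iff) auto
qed

text \<open>If an admissible level \<open>s\<close> were below \<open>f t\<close>, continuity would
  keep \<open>f\<close> above \<open>s\<close> up to some \<open>u > t\<close> inside the interval.
  By monotonicity the superlevel set then contains \<open>{0<..u}\<close>, whose measure exceeds
  \<open>t\<close>. At a jump of \<open>f\<close> the right-continuous rearrangement could fall
  below \<open>f\<close>.\<close>

lemma le_rearrangement:
  fixes f :: "real \<Rightarrow> real"
  assumes cont: "continuous_on {0<..} f"
    and mono: "\<And>s t. 0 < s \<Longrightarrow> s \<le> t \<Longrightarrow> f t \<le> f s"
    and t: "t \<in> einterval 0 L"
  shows "ennreal (f t) \<le> rearrangement L (\<lambda>x. complex_of_real (f x)) t"
  unfolding rearrangement_def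
proof (rule Inf_greatest, safe)
  fix s :: real
  assume s: "s > 0" and le: "emeasure (leb L) {x \<in> einterval 0 L. cmod (complex_of_real (f x)) > s} \<le> ennreal t"
  have meas: "(\<lambda>x. complex_of_real (f x)) \<in> meas_funs L"
    using antimono_measurable_leb[of f L] mono by (simp add: meas_funs_def)
  have t0: "0 < t" "ereal t < L" using t by (auto simp: in_einterval_0_iff)
  show "ennreal (f t) \<le> ennreal s"
  proof (rule ccontr)
    assume "\<not> ennreal (f t) \<le> ennreal s"
    then have lt: "s < f t" by (metis ennreal_leI linorder_not_le)
    have "isCont f t"
      using cont t0 by (simp add: continuous_on_eq_continuous_at)
    then have "(f \<longlongrightarrow> f t) (at_right t)"
      by (simp add: isCont_def filterlim_at_split)
    then have "eventually (\<lambda>y. s < f y) (at_right t)" using lt by (rule order_tendstoD)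
    moreover have "eventually (\<lambda>y. ereal y < L) (at_right t)"
    proof -
      obtain b where "ereal t < ereal b" "ereal b \<le> L"
        using t0(2) by (metis ereal_dense2 less_imp_le)
      then show ?thesis
        unfolding eventually_at_right_field
        by (intro exI[of _ b]) (auto intro: less_le_trans[of _ "ereal b"])
    qed
    moreover have "eventually (\<lambda>y. t < y) (at_right t)" by (simp add: eventually_at_filter)
    ultimately have "eventually (\<lambda>y. s < f y \<and> ereal y < L \<and> t < y) (at_right t)"
      by (simp add: eventually_conj_iff)
    from eventually_happens'[OF trivial_limit_at_right_real this]
    obtain u where u: "s < f u" "ereal u < L" "t < u" by blast
    have u': "u \<in> einterval 0 L" using u t0 by (simp add: in_einterval_0_iff)
    have "ennreal u = emeasure (leb L) {0<..u}" using emeasure_leb_Ioc[OF u'] by simp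
    also have "\<dots> \<le> emeasure (leb L) {x \<in> einterval 0 L. cmod (complex_of_real (f x)) > s}"
    proof (intro emeasure_mono superlevel_sets meas subsetI)
      fix x assume x: "x \<in> {0<..u}"
      then have "s < f x" using mono[of x u] u(1) by auto
      moreover have "ereal x < L" using x u(2) by (auto intro: le_less_trans[of _ "ereal u"])
      ultimately show "x \<in> {x \<in> einterval 0 L. cmod (complex_of_real (f x)) > s}"
        using x by (simp add: in_einterval_0_iff)
    qed
    also have "\<dots> \<le> ennreal t" by (rule le)
    finally show False using u t0 by simp
  qed
qed

text \<open>For \<open>t \<le> b\<close> the level 1 is admissible because no value exceeds it. For
  \<open>t > b\<close> every positive level is admissible; 0 is not itself a level, so it is reached
  only as an infimum.\<close>

lemma rearrangement_indicator_le:
  fixes b :: real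
  assumes "0 < b" "0 < t"
  shows "rearrangement L (indicator {0<..b}) t \<le> indicator {0<..b} t"
proof (cases "t \<le> b")
  case True
  have "cmod (indicator {0<..b} x) \<le> 1" for x :: real
    by (simp add: indicator_def)
  then have "{x \<in> einterval 0 L. cmod (indicator {0<..b} x) > 1} = {}"
    by (auto simp: not_less)
  then have "emeasure (leb L) {x \<in> einterval 0 L. cmod (indicator {0<..b} x) > 1} \<le> ennreal t"
    by (simp only: emeasure_empty) simp
  then have "rearrangement L (indicator {0<..b}) t \<le> ennreal 1"
    unfolding rearrangement_def
    by (intro Inf_lower CollectI exI[of _ 1] conjI) simp_all
  then show ?thesis using True assms by simp
next
  case False
  have le: "rearrangement L (indicator {0<..b}) t \<le> ennreal s" if "s > 0" for s
  proof -
    have "emeasure (leb L) {x \<in> einterval 0 L. cmod (indicator {0<..b} x) > s}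
        = emeasure lebesgue {x \<in> einterval 0 L. cmod (indicator {0<..b} x) > s}"
      by (rule emeasure_restrict_space) auto
    also have "\<dots> \<le> emeasure lebesgue {0<..b}"
      using that by (intro emeasure_mono) (auto simp: indicator_def split: if_splits)
    also have "\<dots> \<le> ennreal t" using False assms by (simp add: ennreal_leI)
    finally show ?thesis
      using that unfolding rearrangement_def by (intro Inf_lower) auto
  qed
  have "rearrangement L (indicator {0<..b}) t \<le> 0"
    by (rule ennreal_le_epsilon) (simp add: le)
  then show ?thesis by simp
qed

section \<open>Quasi-Banach function spaces\<close>

locale ri_quasi_Banach_space =
  fixes L :: ereal and \<rho> :: "(real \<Rightarrow> complex) \<Rightarrow> ennreal"
  assumes L: "1 \<le> L" and ri: "ri_quasi_Banach L \<rho>"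
begin

text \<open>\<open>N\<close> is the quasi-norm of the function space, that is, \<rho> of the
  rearrangement, and \<open>R\<close> is \<rho> itself. They are kept apart because \<rho> need not
  be rearrangement invariant: the Boyd indices are measured by \<open>N\<close>, while the Fatou
  property and the interpolation functional involve \<open>R\<close>.\<close>

abbreviation N :: "(real \<Rightarrow> real) \<Rightarrow> ennreal" where
  "N f \<equiv> ri_norm L \<rho> (\<lambda>t. complex_of_real (f t))"

abbreviation R :: "(real \<Rightarrow> real) \<Rightarrow> ennreal" where
  "R f \<equiv> \<rho> (\<lambda>t. complex_of_real (f t))"

section \<open>Monotonicity, homogeneity and the Fatou property\<close>

lemma meas_funs_of_real:
  "f \<in> borel_measurable (leb L) \<Longrightarrow> (\<lambda>t. complex_of_real (f t)) \<in> meas_funs L"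
  by (simp add: meas_funs_def)

lemma ext_quasi_norms: "ext_quasi_norm L \<rho>" "ext_quasi_norm L (ri_norm L \<rho>)"
  using ri by (auto simp: ri_quasi_Banach_def)

lemma rho_mono_AE:
  "f \<in> meas_funs L \<Longrightarrow> g \<in> meas_funs L \<Longrightarrow> (AE x in leb L. cmod (g x) \<le> cmod (f x)) \<Longrightarrow> \<rho> g \<le> \<rho> f"
  using ri unfolding ri_quasi_Banach_def by blast

lemma R_mono:
  assumes "f \<in> borel_measurable (leb L)" "g \<in> borel_measurable (leb L)"
    "\<And>t. t \<in> einterval 0 L \<Longrightarrow> 0 \<le> g t \<and> g t \<le> f t"
  shows "R g \<le> R f"
  using assms by (intro rho_mono_AE meas_funs_of_real AE_I2) (force simp: space_leb)+

lemma R_Fatou: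
  assumes "\<And>n :: nat. f n \<in> borel_measurable (leb L)" "g \<in> borel_measurable (leb L)"
    "\<And>n t. t \<in> einterval 0 L \<Longrightarrow> 0 \<le> f n t"
    "\<And>t. t \<in> einterval 0 L \<Longrightarrow> incseq (\<lambda>n. f n t)"
    "\<And>t. t \<in> einterval 0 L \<Longrightarrow> (\<lambda>n. f n t) \<longlonglongrightarrow> g t"
    and "\<And>n. R (f n) \<le> B"
  shows "R g \<le> B"
proof -
  have "AE x in leb L. (\<forall>n. 0 \<le> f n x) \<and> incseq (\<lambda>n. f n x) \<and> (\<lambda>n. f n x) \<longlonglongrightarrow> g x"
    using assms by (intro AE_I2) (auto simp: space_leb)
  then have "(\<lambda>n. R (f n)) \<longlonglongrightarrow> R g"
    using ri assms(1,2) unfolding ri_quasi_Banach_def by blast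
  then show ?thesis using assms(6) by (intro LIMSEQ_le_const2) auto
qed

lemma rho_scale: "f \<in> meas_funs L \<Longrightarrow> \<rho> (\<lambda>x. c * f x) = ennreal (cmod c) * \<rho> f"
  using ext_quasi_norms(1) by (auto simp: ext_quasi_norm_def)

lemma R_scale:
  assumes "f \<in> borel_measurable (leb L)" "0 \<le> c"
  shows "R (\<lambda>t. c * f t) = ennreal c * R f"
  using rho_scale[OF meas_funs_of_real[OF assms(1)], of "complex_of_real c"] assms(2) by simp

lemma ri_norm_scale:
  "f \<in> meas_funs L \<Longrightarrow> ri_norm L \<rho> (\<lambda>x. c * f x) = ennreal (cmod c) * ri_norm L \<rho> f"
  using ext_quasi_norms(2) by (auto simp: ext_quasi_norm_def)

lemma N_scale:
  assumes "f \<in> borel_measurable (leb L)" "0 \<le> c"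
  shows "N (\<lambda>t. c * f t) = ennreal c * N f"
  using ri_norm_scale[OF meas_funs_of_real[OF assms(1)], of "complex_of_real c"] assms(2) by simp

lemma R_eq_0_iff:
  assumes "f \<in> borel_measurable (leb L)"
  shows "R f = 0 \<longleftrightarrow> (AE x in leb L. f x = 0)"
  using ext_quasi_norms(1) meas_funs_of_real[OF assms] by (simp add: ext_quasi_norm_def)

lemma rearrangement_measurable: "rearrangement L f \<in> borel_measurable (leb L)"
  by (rule antimono_measurable_leb) (rule rearrangement_antimono)

lemma rearrangement_meas_funs:
  "(\<lambda>t. complex_of_real (enn2real (rearrangement L f t))) \<in> meas_funs L"
  using rearrangement_measurable[of f] by (intro meas_funs_of_real) simp

lemma ri_norm_mono:
  assumes f: "f \<in> meas_funs L" and le: "\<And>x. x \<in> einterval 0 L \<Longrightarrow> cmod (g x) \<le> cmod (f x)"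
  shows "ri_norm L \<rho> g \<le> ri_norm L \<rho> f"
proof (cases "AE t in leb L. rearrangement L f t < \<infinity>")
  case True
  then have "AE t in leb L. rearrangement L g t < \<infinity>"
    by eventually_elim (use rearrangement_mono[OF f le] in \<open>auto intro: le_less_trans\<close>)
  moreover have "\<rho> (\<lambda>t. complex_of_real (enn2real (rearrangement L g t)))
      \<le> \<rho> (\<lambda>t. complex_of_real (enn2real (rearrangement L f t)))"
  proof (intro rho_mono_AE rearrangement_meas_funs)
    show "AE t in leb L. cmod (complex_of_real (enn2real (rearrangement L g t)))
        \<le> cmod (complex_of_real (enn2real (rearrangement L f t)))"
      using True by eventually_elim (use rearrangement_mono[OF f le] in \<open>auto intro: enn2real_mono\<close>)
  qed
  ultimately show ?thesis using True by (simp add: ri_norm_def)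
qed (simp add: ri_norm_def)

lemma N_mono:
  assumes "f \<in> borel_measurable (leb L)"
    "\<And>t. t \<in> einterval 0 L \<Longrightarrow> 0 \<le> g t \<and> g t \<le> f t"
  shows "N g \<le> N f"
  using assms by (intro ri_norm_mono meas_funs_of_real) force+

text \<open>The bridge from the function space back to \<rho>: \<open>le_rearrangement\<close>
  bounds \<open>f\<close> pointwise by its rearrangement, and \<rho> is monotone. If the
  rearrangement is not a.e. finite, \<open>N f\<close> is infinite by convention.\<close>

lemma R_le_N:
  assumes cont: "continuous_on {0<..} f"
    and mono: "\<And>s t. 0 < s \<Longrightarrow> s \<le> t \<Longrightarrow> f t \<le> f s"
    and nonneg: "\<And>t. 0 < t \<Longrightarrow> 0 \<le> f t"
  shows "R f \<le> N f"
proof (cases "AE t in leb L. rearrangement L (\<lambda>t. complex_of_real (f t)) t < \<infinity>")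
  case True
  have "R f \<le> \<rho> (\<lambda>t. complex_of_real (enn2real (rearrangement L (\<lambda>t. complex_of_real (f t)) t)))"
  proof (intro rho_mono_AE rearrangement_meas_funs)
    have "AE t in leb L. t \<in> einterval 0 L" by (rule AE_I2) (simp add: space_leb)
    with True show "AE t in leb L. cmod (complex_of_real (f t))
        \<le> cmod (complex_of_real (enn2real (rearrangement L (\<lambda>t. complex_of_real (f t)) t)))"
    proof eventually_elim
      case (elim t)
      have "0 < t" using elim by (simp add: in_einterval_0_iff)
      then have "f t \<le> enn2real (rearrangement L (\<lambda>t. complex_of_real (f t)) t)"
        using enn2real_mono[OF le_rearrangement[OF cont mono elim(2)]] elim(1) nonneg by simp
      then show ?case using nonneg[OF \<open>0 < t\<close>] by simp
    qed
    show "(\<lambda>t. complex_of_real (f t)) \<in> meas_funs L"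
      by (intro meas_funs_of_real antimono_measurable_leb mono)
  qed
  then show ?thesis using True by (simp add: ri_norm_def)
qed (simp add: ri_norm_def)

lemma indicator_measurable: "(indicator {0<..b} :: real \<Rightarrow> real) \<in> borel_measurable (leb L)"
  by (intro antimono_measurable_leb) (auto simp: indicator_def)

text \<open>On the interval the rearrangement is dominated by the indicator of a set of finite
  measure, whose \<rho> is finite by axiom.\<close>

lemma N_indicator_finite:
  fixes b :: real
  assumes "0 < b"
  shows "N (indicator {0<..b}) < \<infinity>"
proof -
  have le: "rearrangement L (indicator {0<..b}) t \<le> indicator {0<..b} t" if "t \<in> einterval 0 L" for t
    using that rearrangement_indicator_le[OF assms] by (simp add: in_einterval_0_iff)
  have AE: "AE t in leb L. rearrangement L (indicator {0<..b}) t < \<infinity>"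
    by (rule AE_I2) (use le in \<open>force simp: space_leb indicator_def intro: le_less_trans split: if_splits\<close>)
  have ind: "indicator ({0<..b} \<inter> einterval 0 L) \<in> meas_funs L"
    unfolding meas_funs_def
    by (intro borel_measurable_indicator) (auto simp: sets_restrict_space)
  have "\<rho> (\<lambda>t. complex_of_real (enn2real (rearrangement L (indicator {0<..b}) t)))
      \<le> \<rho> (indicator ({0<..b} \<inter> einterval 0 L))"
  proof (intro rho_mono_AE rearrangement_meas_funs ind AE_I2)
    fix t assume "t \<in> space (leb L)"
    then have t: "t \<in> einterval 0 L" by (simp add: space_leb)
    have "enn2real (rearrangement L (indicator {0<..b}) t) \<le> enn2real (indicator {0<..b} t)"
      by (rule enn2real_mono[OF le[OF t]]) (simp add: indicator_def)
    then show "cmod (complex_of_real (enn2real (rearrangement L (indicator {0<..b}) t)))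
        \<le> cmod (indicator ({0<..b} \<inter> einterval 0 L) t)"
      using t by (auto simp: indicator_def split: if_splits)
  qed
  also have "\<dots> < \<infinity>"
  proof -
    have "emeasure lebesgue ({0<..b} \<inter> einterval 0 L) \<le> emeasure lebesgue {0<..b}"
      by (rule emeasure_mono) auto
    also have "\<dots> < \<infinity>" using assms by simp
    finally show ?thesis using ri unfolding ri_quasi_Banach_def by auto
  qed
  finally have "ri_norm L \<rho> (indicator {0<..b}) < \<infinity>" using AE by (simp add: ri_norm_def)
  moreover have "(\<lambda>t. complex_of_real (indicator {0<..b} t)) = indicator {0<..b}"
    by (auto simp: indicator_def)
  ultimately show ?thesis by simp
qed

lemma N_triangle:
  obtains C where "C \<ge> 1"
    "\<And>f g. f \<in> borel_measurable (leb L) \<Longrightarrow> g \<in> borel_measurable (leb L) \<Longrightarrow>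
       N (\<lambda>t. f t + g t) \<le> ennreal C * (N f + N g)"
proof -
  obtain C where "C \<ge> 1" "ext_triangle_const L (ri_norm L \<rho>) C"
    using ext_quasi_norms(2) by (auto simp: ext_quasi_norm_def)
  with that show ?thesis
    by (force simp: ext_triangle_const_def dest: meas_funs_of_real)
qed

lemma R_triangle:
  assumes "ext_triangle_const L \<rho> C"
    "f \<in> borel_measurable (leb L)" "g \<in> borel_measurable (leb L)"
  shows "R (\<lambda>t. f t + g t) \<le> ennreal C * (R f + R g)"
  using assms(1) meas_funs_of_real[OF assms(2)] meas_funs_of_real[OF assms(3)]
  by (simp add: ext_triangle_const_def)

section \<open>Uniform bounds for self-similar sequences\<close>

text \<open>
  Dilating \<open>f n\<close> by \<open>a\<close> reproduces \<open>f (Suc n)\<close> up to the factor \<open>w\<close> and a bounded error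
  near 0, so the quasi-norms of the \<open>f n\<close> satisfy a contractive recursion as soon as
  \<open>C * w * d \<le> 1 / 2\<close>, where \<open>C\<close> is the quasi-triangle constant.
\<close>

lemma N_selfsimilar_bound:
  fixes f :: "nat \<Rightarrow> real \<Rightarrow> real"
  assumes C: "C \<ge> 1"
    "\<And>f g. f \<in> borel_measurable (leb L) \<Longrightarrow> g \<in> borel_measurable (leb L) \<Longrightarrow>
       N (\<lambda>t. f t + g t) \<le> ennreal C * (N f + N g)"
    and a: "0 < a" and b: "0 < b" and k: "0 \<le> k" and w: "0 \<le> w" and d: "0 \<le> d"
    and Cwd: "C * w * d \<le> 1 / 2"
    and dil: "\<And>h. h \<in> ri_space L \<rho> \<Longrightarrow> ri_norm L \<rho> (dilation L a h) \<le> ennreal d * ri_norm L \<rho> h"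
    and mono: "\<And>n s t. 0 < s \<Longrightarrow> s \<le> t \<Longrightarrow> f n t \<le> f n s"
    and nonneg: "\<And>n t. 0 < t \<Longrightarrow> 0 \<le> f n t"
    and f0: "\<And>t. 0 < t \<Longrightarrow> f 0 t = 0"
    and step: "\<And>n t. t \<in> einterval 0 L \<Longrightarrow>
      f (Suc n) t \<le> k * indicator {0<..b} t + w * (if a * t \<in> einterval 0 L then f n (a * t) else 0)"
  shows "N (f n) \<le> ennreal (2 * C * k) * N (indicator {0<..b})"
proof (induction n)
  case 0
  have "N (f 0) \<le> N (\<lambda>t. 0 * indicator {0<..b} t)"
    using f0 nonneg by (intro N_mono) (auto simp: in_einterval_0_iff)
  also have "\<dots> = 0" using N_scale[OF indicator_measurable, of 0 b] by simp
  finally show ?case by simp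
next
  case (Suc n)
  \<comment> \<open>The dilation of \<open>f n\<close>, which is 0 once \<open>a * t\<close> leaves
    the interval. It stays non-increasing because \<open>f n\<close> is non-negative.\<close>
  define g where "g = (\<lambda>t. if a * t \<in> einterval 0 L then f n (a * t) else 0)"
  have gmono: "g t \<le> g s" if "0 < s" "s \<le> t" for s t
  proof -
    have "a * s \<le> a * t" "0 < a * s" using that a by auto
    then show ?thesis
      using mono[of "a * s" "a * t" n] nonneg[of "a * s" n] that a
      by (auto simp: g_def in_einterval_0_iff intro: le_less_trans[of _ "ereal (a * t)"])
  qed
  have gmeas: "g \<in> borel_measurable (leb L)" by (rule antimono_measurable_leb[OF gmono])
  have fmeas: "f n \<in> borel_measurable (leb L)" by (rule antimono_measurable_leb[OF mono])
  have gdil: "(\<lambda>t. complex_of_real (g t)) = dilation L a (\<lambda>t. complex_of_real (f n t))"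
    by (auto simp: g_def dilation_def)
  have B: "N (indicator {0<..b}) < \<infinity>" by (rule N_indicator_finite[OF b])
  \<comment> \<open>The induction hypothesis also gives finiteness of \<open>N (f n)\<close>, so
    \<open>f n\<close> lies in the space and the dilation bound applies to it.\<close>
  have "(\<lambda>t. complex_of_real (f n t)) \<in> ri_space L \<rho>"
    unfolding ri_space_def using meas_funs_of_real[OF fmeas] Suc B
    by (auto intro: le_less_trans simp: ennreal_mult_less_top)
  from dil[OF this] have Ng: "N g \<le> ennreal d * N (f n)" by (simp add: gdil)
  have "N (f (Suc n)) \<le> N (\<lambda>t. k * indicator {0<..b} t + w * g t)"
    using step nonneg gmeas indicator_measurable by (intro N_mono) (auto simp: g_def in_einterval_0_iff)
  also have "\<dots> \<le> ennreal C * (N (\<lambda>t. k * indicator {0<..b} t) + N (\<lambda>t. w * g t))"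
    using gmeas indicator_measurable by (intro C(2)) auto
  also have "\<dots> = ennreal C * (ennreal k * N (indicator {0<..b}) + ennreal w * N g)"
    by (simp only: N_scale[OF indicator_measurable k] N_scale[OF gmeas w])
  also have "\<dots> \<le> ennreal C * (ennreal k * N (indicator {0<..b})
      + ennreal w * (ennreal d * (ennreal (2 * C * k) * N (indicator {0<..b}))))"
    by (intro mult_left_mono add_left_mono order_trans[OF Ng] Suc) auto
  also have "\<dots> = ennreal (C * k + C * w * d * (2 * C * k)) * N (indicator {0<..b})"
    using C(1) k w d by (simp add: ennreal_plus ennreal_mult algebra_simps)
  also have "\<dots> \<le> ennreal (2 * C * k) * N (indicator {0<..b})"
  proof (intro mult_right_mono ennreal_leI)
    \<comment> \<open>The bound \<open>2 * C * k\<close> solves \<open>B = C * k + B / 2\<close>,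
      the worst recursion that \<open>Cwd\<close> allows.\<close>
    have "C * w * d * (2 * C * k) \<le> 1 / 2 * (2 * C * k)"
      using Cwd C(1) k by (intro mult_right_mono) auto
    then show "C * k + C * w * d * (2 * C * k) \<le> 2 * C * k" by simp
  qed auto
  finally show ?case .
qed

text \<open>\<open>R_le_N\<close> transfers the bound, uniform in \<open>n\<close>, from
  \<open>N\<close> to \<open>R\<close>, where the Fatou property carries it to the pointwise limit.
  Continuity of the \<open>f n\<close> serves this transfer.\<close>

lemma R_selfsimilar_limit:
  fixes f :: "nat \<Rightarrow> real \<Rightarrow> real"
  assumes C: "C \<ge> 1"
    "\<And>f g. f \<in> borel_measurable (leb L) \<Longrightarrow> g \<in> borel_measurable (leb L) \<Longrightarrow>
       N (\<lambda>t. f t + g t) \<le> ennreal C * (N f + N g)"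
    and a: "0 < a" and b: "0 < b" and k: "0 \<le> k" and w: "0 \<le> w" and d: "0 \<le> d"
    and Cwd: "C * w * d \<le> 1 / 2"
    and dil: "\<And>h. h \<in> ri_space L \<rho> \<Longrightarrow> ri_norm L \<rho> (dilation L a h) \<le> ennreal d * ri_norm L \<rho> h"
    and mono: "\<And>n s t. 0 < s \<Longrightarrow> s \<le> t \<Longrightarrow> f n t \<le> f n s"
    and nonneg: "\<And>n t. 0 < t \<Longrightarrow> 0 \<le> f n t"
    and f0: "\<And>t. 0 < t \<Longrightarrow> f 0 t = 0"
    and step: "\<And>n t. t \<in> einterval 0 L \<Longrightarrow>
      f (Suc n) t \<le> k * indicator {0<..b} t + w * (if a * t \<in> einterval 0 L then f n (a * t) else 0)"
    and cont: "\<And>n. continuous_on {0<..} (f n)"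
    and inc: "\<And>t. 0 < t \<Longrightarrow> incseq (\<lambda>n. f n t)"
    and lim: "\<And>t. 0 < t \<Longrightarrow> (\<lambda>n. f n t) \<longlonglongrightarrow> g t"
  shows "R g < \<infinity>"
proof -
  have gmono: "g t \<le> g s" if "0 < s" "s \<le> t" for s t
    using that by (intro LIMSEQ_le[OF lim lim] exI[of _ 0]) (auto intro: mono)
  have "R g \<le> ennreal (2 * C * k) * N (indicator {0<..b})"
  proof (rule R_Fatou[where f = f])
    show "R (f n) \<le> ennreal (2 * C * k) * N (indicator {0<..b})" for n
      using R_le_N[OF cont mono nonneg] N_selfsimilar_bound[OF C a b k w d Cwd dil mono nonneg f0 step]
      by (meson order_trans)
    show "f n \<in> borel_measurable (leb L)" for n by (rule antimono_measurable_leb[OF mono])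
    show "g \<in> borel_measurable (leb L)" by (rule antimono_measurable_leb[OF gmono])
  qed (use inc lim nonneg in \<open>auto simp: in_einterval_0_iff\<close>)
  also have "\<dots> < \<infinity>" using N_indicator_finite[OF b] by (simp add: ennreal_mult_less_top)
  finally show ?thesis .
qed

section \<open>Boyd indices and finiteness of the weight\<close>

lemma dilation_norm_bound:
  assumes "dilation_norm L \<rho> a \<le> ennreal c" "0 < c" "h \<in> ri_space L \<rho>"
  shows "ri_norm L \<rho> (dilation L a h) \<le> ennreal (2 * c) * ri_norm L \<rho> h"
proof -
  \<comment> \<open>\<open>dilation_norm\<close> is an infimum; doubling the positive
    \<open>c\<close> leaves room to pick an actual constant \<open>D\<close> without showing that
    the infimum is attained.\<close>
  have "dilation_norm L \<rho> a < ennreal (2 * c)"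
    using assms(1) by (rule le_less_trans) (use assms(2) in \<open>simp add: ennreal_less_iff\<close>)
  then obtain D where "D < ennreal (2 * c)"
    "\<forall>f\<in>ri_space L \<rho>. ri_norm L \<rho> (dilation L a f) \<le> D * ri_norm L \<rho> f"
    unfolding dilation_norm_def Inf_less_iff by blast
  then show ?thesis
    using assms(3) by (meson less_imp_le mult_right_mono order_trans zero_le)
qed

text \<open>
  The truncations by \<open>w ^ n\<close>, where \<open>w = M powr (- 1 / r)\<close>, are dilations of each other by \<open>1 / M\<close>
  on \<open>(M, \<infinity>)\<close>. Since \<open>r\<close> is below the lower Boyd index, \<open>w\<close> beats the norm of the dilation
  once \<open>M\<close> is large.
\<close>

lemma R_power_tail_finite:
  assumes r: "0 < r" and lower: "ennreal r < lower_Boyd L \<rho>"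
  shows "R (\<lambda>t. min 1 (t powr (- 1 / r))) < \<infinity>"
proof -
  obtain C where C: "C \<ge> 1"
    "\<And>f g. f \<in> borel_measurable (leb L) \<Longrightarrow> g \<in> borel_measurable (leb L) \<Longrightarrow>
       N (\<lambda>t. f t + g t) \<le> ennreal C * (N f + N g)"
    using N_triangle by blast
  obtain p c where p: "r < p" and c: "0 < c"
    and dil: "\<And>a. 0 < a \<Longrightarrow> a < 1 \<Longrightarrow> dilation_norm L \<rho> a \<le> ennreal (c * a powr (- 1 / p))"
    using lower r unfolding lower_Boyd_def less_Sup_iff by (auto simp: ennreal_less_iff)
  \<comment> \<open>\<open>\<delta>\<close> is the gap between the exponents, and \<open>M\<close>
    is so large that \<open>4 * C * c \<le> M powr \<delta>\<close>. Together with the factor 2 in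
    \<open>d\<close>, which comes from \<open>dilation_norm_bound\<close>, this yields
    \<open>C * w * d \<le> 1 / 2\<close>.\<close>
  define \<delta> where "\<delta> = 1 / r - 1 / p"
  have \<delta>: "\<delta> > 0" using p r by (simp add: \<delta>_def field_simps)
  define M where "M = max 2 ((4 * C * c) powr (1 / \<delta>))"
  have M: "M > 1" by (simp add: M_def)
  have "(4 * C * c) = ((4 * C * c) powr (1 / \<delta>)) powr \<delta>"
    using \<delta> C(1) c by (simp add: powr_powr)
  also have "\<dots> \<le> M powr \<delta>" using \<delta> by (intro powr_mono2) (auto simp: M_def)
  finally have M\<delta>: "4 * C * c \<le> M powr \<delta>" .
  define w where "w = M powr (- 1 / r)"
  define d where "d = 2 * (c * (1 / M) powr (- 1 / p))"
  have w: "0 < w" "w < 1" using M r by (auto simp: w_def powr_less_one)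
  have w_r: "w * (t / M) powr (- 1 / r) = t powr (- 1 / r)" if "0 < t" for t
    using M that by (simp add: w_def powr_mult[symmetric])
  have "w * (1 / M) powr (- 1 / p) = M powr (- \<delta>)"
    using M by (simp add: w_def \<delta>_def powr_divide powr_minus_divide powr_diff)
  moreover have "C * w * d = 2 * C * c * (w * (1 / M) powr (- 1 / p))"
    by (simp only: d_def mult_ac)
  ultimately have "C * w * d = 2 * C * c / M powr \<delta>"
    by (simp only: powr_minus_divide) simp
  also have "\<dots> \<le> 1 / 2" using M\<delta> M by (simp add: divide_le_eq)
  finally have Cwd: "C * w * d \<le> 1 / 2" .
  have anti: "t powr (- 1 / r) \<le> s powr (- 1 / r)" if "0 < s" "s \<le> t" for s t
    using that r by (intro powr_mono2') auto
  show ?thesis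
  \<comment> \<open>Subtracting \<open>w ^ n\<close> and cutting at 0 keeps continuity, makes the
    function of index 0 vanish because \<open>w ^ 0 = 1\<close>, and gives a sequence increasing to
    the untruncated function since \<open>w < 1\<close>.\<close>
  proof (rule R_selfsimilar_limit[where a = "1 / M" and b = M and k = 1 and w = w and d = d and
        f = "\<lambda>n t. max 0 (min 1 (t powr (- 1 / r)) - w ^ n)", OF C])
    show "ri_norm L \<rho> (dilation L (1 / M) h) \<le> ennreal d * ri_norm L \<rho> h"
      if "h \<in> ri_space L \<rho>" for h
      unfolding d_def using M c that by (intro dilation_norm_bound dil) auto
  next
    fix n t assume t: "t \<in> einterval 0 L"
    then have t0: "0 < t" "ereal t < L" by (auto simp: in_einterval_0_iff)
    have "t / M \<le> t" using t0 M by (simp add: divide_le_eq)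
    then have "ereal (t / M) < L" using t0 by (auto intro: le_less_trans[of _ "ereal t"])
    then have in_L: "1 / M * t \<in> einterval 0 L" using t0 M by (simp add: in_einterval_0_iff)
    have "max 0 (min 1 (t powr (- 1 / r)) - w ^ Suc n)
      \<le> indicator {0<..M} t + w * max 0 (min 1 ((t / M) powr (- 1 / r)) - w ^ n)"
    \<comment> \<open>On \<open>{0<..M}\<close> the indicator absorbs everything. Beyond
      \<open>M\<close> neither minimum with 1 is active, so \<open>w_r\<close> turns the recursion
      into an identity.\<close>
    proof (cases "t \<le> M")
      case True
      have "max 0 (min 1 (t powr (- 1 / r)) - w ^ Suc n) \<le> 1"
        using zero_le_power[of w "Suc n"] w by linarith
      moreover have "0 \<le> w * max 0 (min 1 ((t / M) powr (- 1 / r)) - w ^ n)" using w by simp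
      ultimately show ?thesis using True t0 by simp
    next
      case False
      then have "t powr (- 1 / r) \<le> 1" "(t / M) powr (- 1 / r) \<le> 1"
        using anti[of 1 t] anti[of 1 "t / M"] M by auto
      moreover have "w * max 0 ((t / M) powr (- 1 / r) - w ^ n)
          = max 0 (w * (t / M) powr (- 1 / r) - w * w ^ n)"
        using w by (simp add: max_mult_distrib_left right_diff_distrib)
      ultimately show ?thesis using False t0 w_r by simp
    qed
    then show "max 0 (min 1 (t powr (- 1 / r)) - w ^ Suc n)
      \<le> 1 * indicator {0<..M} t + w * (if 1 / M * t \<in> einterval 0 L
          then max 0 (min 1 ((1 / M * t) powr (- 1 / r)) - w ^ n) else 0)"
      using in_L by simp
  next
    fix n :: nat
    show "continuous_on {0<..} (\<lambda>t. max 0 (min 1 (t powr (- 1 / r)) - w ^ n))"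
      by (intro continuous_intros) auto
  next
    fix t :: real assume t: "0 < t"
    show "incseq (\<lambda>n. max 0 (min 1 (t powr (- 1 / r)) - w ^ n))"
      using w by (intro incseq_SucI max.mono diff_left_mono) (auto simp: mult_le_cancel_right1)
    have "(\<lambda>n. max 0 (min 1 (t powr (- 1 / r)) - w ^ n)) \<longlonglongrightarrow> max 0 (min 1 (t powr (- 1 / r)) - 0)"
      using w by (intro tendsto_intros LIMSEQ_realpow_zero) auto
    then show "(\<lambda>n. max 0 (min 1 (t powr (- 1 / r)) - w ^ n)) \<longlonglongrightarrow> min 1 (t powr (- 1 / r))"
      by simp
  next
    fix n :: nat and s t :: real assume "0 < s" "s \<le> t"
    then show "max 0 (min 1 (t powr (- 1 / r)) - w ^ n) \<le> max 0 (min 1 (s powr (- 1 / r)) - w ^ n)"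
      using anti[of s t] by auto
  qed (use M w c Cwd in \<open>auto simp: d_def\<close>)
qed

text \<open>The counterpart of the tail near 0: the truncations are now from above at
  \<open>w ^ n\<close> with \<open>w = M powr s > 1\<close>, and the dilation is by \<open>M\<close>
  instead of \<open>1 / M\<close>. Subtracting 1 removes everything beyond \<open>t = 1\<close>, so
  only the singularity is measured.\<close>

lemma R_power_singularity_finite:
  assumes s: "0 < s" and upper: "upper_Boyd L \<rho> < ennreal (1 / s)"
  shows "R (\<lambda>t. max 0 (t powr (- s) - 1)) < \<infinity>"
proof -
  obtain C where C: "C \<ge> 1"
    "\<And>f g. f \<in> borel_measurable (leb L) \<Longrightarrow> g \<in> borel_measurable (leb L) \<Longrightarrow>
       N (\<lambda>t. f t + g t) \<le> ennreal C * (N f + N g)"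
    using N_triangle by blast
  obtain q c where q: "0 < q" "q < 1 / s" and c: "0 < c"
    and dil: "\<And>a. 1 \<le> a \<Longrightarrow> dilation_norm L \<rho> a \<le> ennreal (c * a powr (- 1 / q))"
    using upper unfolding upper_Boyd_def Inf_less_iff by (auto simp: ennreal_less_iff)
  \<comment> \<open>The truncation levels grow by \<open>M powr s\<close> while the dilation norm
    decays like \<open>M powr (- 1 / q)\<close>; since \<open>s < 1 / q\<close>, the decay wins for
    large \<open>M\<close>.\<close>
  define \<delta> where "\<delta> = 1 / q - s"
  have \<delta>: "\<delta> > 0" using q s by (simp add: \<delta>_def field_simps)
  define M where "M = max 2 ((4 * C * c) powr (1 / \<delta>))"
  have M: "M > 1" by (simp add: M_def)
  have "(4 * C * c) = ((4 * C * c) powr (1 / \<delta>)) powr \<delta>"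
    using \<delta> C(1) c by (simp add: powr_powr)
  also have "\<dots> \<le> M powr \<delta>" using \<delta> by (intro powr_mono2) (auto simp: M_def)
  finally have M\<delta>: "4 * C * c \<le> M powr \<delta>" .
  define w where "w = M powr s"
  define d where "d = 2 * (c * M powr (- 1 / q))"
  have w: "1 < w" using M s by (simp add: w_def)
  have w_s: "w * (M * t) powr (- s) = t powr (- s)" if "0 < t" for t
    using M that by (simp add: w_def powr_mult powr_minus field_simps)
  have "w * M powr (- 1 / q) = M powr (- \<delta>)"
    by (simp add: w_def \<delta>_def powr_add[symmetric])
  moreover have "C * w * d = 2 * C * c * (w * M powr (- 1 / q))"
    by (simp only: d_def mult_ac)
  ultimately have "C * w * d = 2 * C * c / M powr \<delta>"
    by (simp only: powr_minus_divide) simp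
  also have "\<dots> \<le> 1 / 2" using M\<delta> M by (simp add: divide_le_eq)
  finally have Cwd: "C * w * d \<le> 1 / 2" .
  have anti: "t powr (- s) \<le> u powr (- s)" if "0 < u" "u \<le> t" for u t
    using that s by (intro powr_mono2') auto
  show ?thesis
  proof (rule R_selfsimilar_limit[where a = M and b = 1 and k = w and w = w and d = d and
        f = "\<lambda>n t. max 0 (min (t powr (- s)) (w ^ n) - 1)", OF C])
    show "ri_norm L \<rho> (dilation L M h) \<le> ennreal d * ri_norm L \<rho> h"
      if "h \<in> ri_space L \<rho>" for h
      unfolding d_def using M c that by (intro dilation_norm_bound dil) auto
  next
    fix n t assume t: "t \<in> einterval 0 L"
    then have t0: "0 < t" "ereal t < L" by (auto simp: in_einterval_0_iff)
    show "max 0 (min (t powr (- s)) (w ^ Suc n) - 1)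
      \<le> w * indicator {0<..1} t + w * (if M * t \<in> einterval 0 L
          then max 0 (min ((M * t) powr (- s)) (w ^ n) - 1) else 0)"
    proof (cases "t \<le> 1")
      case False
      then have "t powr (- s) \<le> 1" using anti[of 1 t] by simp
      then show ?thesis using w by simp
    next
      case True
      show ?thesis
      proof (cases "M * t \<in> einterval 0 L")
        case True
        have "min (t powr (- s)) (w ^ Suc n) = w * min ((M * t) powr (- s)) (w ^ n)"
          using w w_s[OF t0(1)] by (simp add: min_mult_distrib_left)
        \<comment> \<open>The recursion is exact before 1 is subtracted; restoring the subtraction
          costs the summand \<open>w\<close>, which is why \<open>k\<close> is
          \<open>w\<close>.\<close>
        also have "\<dots> = w + w * (min ((M * t) powr (- s)) (w ^ n) - 1)"
          by (simp add: algebra_simps)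
        also have "\<dots> \<le> w + w * max 0 (min ((M * t) powr (- s)) (w ^ n) - 1)"
          using w by (intro add_left_mono mult_left_mono) auto
        finally have "min (t powr (- s)) (w ^ Suc n)
            \<le> w + w * max 0 (min ((M * t) powr (- s)) (w ^ n) - 1)" .
        moreover have "0 \<le> w * max 0 (min ((M * t) powr (- s)) (w ^ n) - 1)" using w by simp
        ultimately show ?thesis using True \<open>t \<le> 1\<close> t0 w by simp
      next
        case False
        \<comment> \<open>Here the dilation is 0, but \<open>M * t \<ge> L \<ge> 1\<close> forces
          \<open>t powr (- s) \<le> w\<close>, so the error term suffices.\<close>
        then have "L \<le> ereal (M * t)" using t0 M by (simp add: in_einterval_0_iff not_less)
        then have "1 \<le> ereal (M * t)" using L by (rule order_trans[rotated])
        then have "(M * t) powr (- s) \<le> 1" using anti[of 1 "M * t"] by (simp add: one_ereal_def)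
        then have "t powr (- s) \<le> w * 1"
          unfolding w_s[OF t0(1), symmetric] using w by (intro mult_left_mono) auto
        then show ?thesis using False \<open>t \<le> 1\<close> t0 w by simp
      qed
    qed
  next
    fix n :: nat
    show "continuous_on {0<..} (\<lambda>t. max 0 (min (t powr (- s)) (w ^ n) - 1))"
      by (intro continuous_intros) auto
  next
    fix t :: real assume t: "0 < t"
    show "incseq (\<lambda>n. max 0 (min (t powr (- s)) (w ^ n) - 1))"
      using w by (intro incseq_SucI max.mono diff_right_mono min.mono) auto
    \<comment> \<open>Once \<open>w ^ n\<close> exceeds \<open>t powr (- s)\<close> the truncation
      is inactive, so at each point the sequence is eventually constant.\<close>
    obtain n0 where n0: "t powr (- s) < w ^ n0" using real_arch_pow[OF w] by blast
    have "max 0 (min (t powr (- s)) (w ^ n) - 1) = max 0 (t powr (- s) - 1)" if "n \<ge> n0" for n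
      using n0 power_increasing[OF that, of w] w by linarith
    then show "(\<lambda>n. max 0 (min (t powr (- s)) (w ^ n) - 1)) \<longlonglongrightarrow> max 0 (t powr (- s) - 1)"
      by (intro tendsto_eventually) (auto simp: eventually_sequentially)
  next
    fix n :: nat and u t :: real assume "0 < u" "u \<le> t"
    then show "max 0 (min (t powr (- s)) (w ^ n) - 1) \<le> max 0 (min (u powr (- s)) (w ^ n) - 1)"
      using anti[of u t] by auto
  qed (use M w c Cwd in \<open>auto simp: d_def\<close>)
qed

lemma powr_measurable: "(\<lambda>t. t powr a) \<in> borel_measurable (leb L)"
  by (intro measurable_leb measurable_restrict_space1) simp

text \<open>With \<open>s = 1 / r - 1 / \<Theta>\<close> the weight equals the tail
  \<open>\<psi>\<close> on \<open>[1, \<infinity>)\<close> and \<open>t powr (- s)\<close> on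
  \<open>(0, 1)\<close>. For \<open>s > 0\<close> it is at most \<open>\<psi> + g\<close>, and the
  index condition makes the upper index finite and below \<open>1 / s\<close>; for
  \<open>s \<le> 0\<close> it is at most \<open>\<psi>\<close>.\<close>

lemma R_weight_finite:
  assumes \<Theta>: "0 < \<Theta>" and r: "0 < r" and lower: "ennreal r < lower_Boyd L \<rho>"
    and fin: "upper_Boyd L \<rho> < \<infinity> \<Longrightarrow> 1 / \<Theta> + 1 / enn2real (upper_Boyd L \<rho>) > 1 / r"
    and inf: "upper_Boyd L \<rho> = \<infinity> \<Longrightarrow> 1 / \<Theta> \<ge> 1 / r"
  shows "R (\<lambda>t. t powr (- 1 / r) * min 1 (t powr (1 / \<Theta>))) < \<infinity>"
proof -
  define s where "s = 1 / r - 1 / \<Theta>"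
  define \<phi> where "\<phi> = (\<lambda>t. t powr (- 1 / r) * min 1 (t powr (1 / \<Theta>)))"
  define \<psi> where "\<psi> = (\<lambda>t. min 1 (t powr (- 1 / r)))"
  define g where "g = (\<lambda>t. max 0 (t powr (- s) - 1))"
  have meas: "\<phi> \<in> borel_measurable (leb L)" "\<psi> \<in> borel_measurable (leb L)"
    "g \<in> borel_measurable (leb L)"
    unfolding \<phi>_def \<psi>_def g_def using powr_measurable by simp_all
  have \<psi>: "R \<psi> < \<infinity>" unfolding \<psi>_def by (rule R_power_tail_finite[OF r lower])
  have large: "\<phi> t = \<psi> t" if "1 \<le> t" for t
  proof -
    have "1 \<le> t powr (1 / \<Theta>)" using that \<Theta> by (intro ge_one_powr_ge_zero) auto
    moreover have "t powr (- 1 / r) \<le> 1 powr (- 1 / r)" using that r by (intro powr_mono2') auto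
    ultimately show ?thesis by (simp add: \<phi>_def \<psi>_def)
  qed
  have small: "\<phi> t = t powr (- s)" "\<psi> t = 1" if "0 < t" "t < 1" for t
  proof -
    have "t powr (1 / \<Theta>) \<le> 1 powr (1 / \<Theta>)" using that \<Theta> by (intro powr_mono2) auto
    then show "\<phi> t = t powr (- s)"
      by (simp add: \<phi>_def s_def powr_add[symmetric])
    have "1 powr (- 1 / r) \<le> t powr (- 1 / r)" using that r by (intro powr_mono2') auto
    then show "\<psi> t = 1" by (simp add: \<psi>_def)
  qed
  have "R \<phi> < \<infinity>"
  proof (cases "0 < s")
    case True
    have "upper_Boyd L \<rho> \<noteq> \<infinity>" using inf True by (auto simp: s_def)
    then have ub: "upper_Boyd L \<rho> < \<infinity>" by (metis infinity_ennreal_def top.not_eq_extremum)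
    then have q: "s < 1 / enn2real (upper_Boyd L \<rho>)" using fin by (simp add: s_def)
    \<comment> \<open>This excludes the index 0, where \<open>1 / 0 = 0\<close>, so that the
      inequality can be inverted.\<close>
    then have "0 < 1 / enn2real (upper_Boyd L \<rho>)" using True by linarith
    then have q0: "0 < enn2real (upper_Boyd L \<rho>)" by simp
    then have "enn2real (upper_Boyd L \<rho>) < 1 / s" using q True by (simp add: field_simps)
    then have "upper_Boyd L \<rho> < ennreal (1 / s)"
      using ub q0 by (metis ennreal_enn2real ennreal_lessI infinity_ennreal_def order_less_trans)
    then have g: "R g < \<infinity>" unfolding g_def by (rule R_power_singularity_finite[OF True])
    obtain D where "ext_triangle_const L \<rho> D"
      using ext_quasi_norms(1) by (auto simp: ext_quasi_norm_def)
    then have "R (\<lambda>t. \<psi> t + g t) \<le> ennreal D * (R \<psi> + R g)"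
      using meas by (intro R_triangle)
    also have "\<dots> < \<infinity>" using \<psi> g by (simp add: ennreal_mult_less_top)
    finally have "R (\<lambda>t. \<psi> t + g t) < \<infinity>" .
    moreover have "R \<phi> \<le> R (\<lambda>t. \<psi> t + g t)"
    proof (rule R_mono)
      fix t assume "t \<in> einterval 0 L"
      then have "0 < t" by (simp add: in_einterval_0_iff)
      then show "0 \<le> \<phi> t \<and> \<phi> t \<le> \<psi> t + g t"
        using large[of t] small[of t] by (cases "1 \<le> t") (auto simp: \<phi>_def \<psi>_def g_def)
    qed (use meas in simp_all)
    ultimately show ?thesis by (rule le_less_trans[rotated])
  next
    case False
    have "R \<phi> \<le> R \<psi>"
    proof (rule R_mono)
      fix t assume "t \<in> einterval 0 L"
      then have t: "0 < t" by (simp add: in_einterval_0_iff)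
      have "\<phi> t \<le> \<psi> t"
      proof (cases "1 \<le> t")
        case False
        have "t powr (- s) \<le> 1 powr (- s)"
          using t False \<open>\<not> 0 < s\<close> by (intro powr_mono2) auto
        then show ?thesis using small[of t] t False by simp
      qed (simp add: large)
      then show "0 \<le> \<phi> t \<and> \<phi> t \<le> \<psi> t" by (simp add: \<phi>_def)
    qed (use meas in simp_all)
    then show ?thesis using \<psi> by (rule le_less_trans)
  qed
  then show ?thesis by (simp add: \<phi>_def)
qed

text \<open>The weight is positive throughout the interval, so by definiteness a zero value would
  make the interval null, although it contains \<open>{0<..1 / 2}\<close>.\<close>

lemma R_weight_nonzero: "R (\<lambda>t. t powr (- 1 / r) * min 1 (t powr (1 / \<Theta>))) \<noteq> 0"
proof
  assume "R (\<lambda>t. t powr (- 1 / r) * min 1 (t powr (1 / \<Theta>))) = 0"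
  then have "AE t in leb L. t powr (- 1 / r) * min 1 (t powr (1 / \<Theta>)) = 0"
    using powr_measurable by (subst (asm) R_eq_0_iff) simp_all
  moreover have "AE t in leb L. t \<in> einterval 0 L" by (rule AE_I2) (simp add: space_leb)
  ultimately have "AE t in leb L. False"
    by eventually_elim (auto simp: in_einterval_0_iff min_def split: if_splits)
  then have "emeasure (leb L) (space (leb L)) = 0"
    by (simp add: trivial_limit_def[symmetric] ae_filter_eq_bot_iff)
  moreover have half: "1 / 2 \<in> einterval 0 L"
    using less_le_trans[OF _ L, of "ereal (1 / 2)"] by (simp add: in_einterval_0_iff one_ereal_def)
  moreover have "emeasure (leb L) {0<..1 / 2} \<le> emeasure (leb L) (space (leb L))"
    using emeasure_leb_Ioc(2)[OF half] by (rule emeasure_mono[OF sets.sets_into_space]) simp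
  ultimately show False using emeasure_leb_Ioc(1)[OF half] by simp
qed

end

section \<open>The K-functional\<close>

text \<open>One constant \<open>C\<close> serves both spaces: the larger of the two in general, and
  1 for a normed couple.\<close>

locale quasi_normed_couple = vector_space smul
  for smul :: "'k::real_normed_field \<Rightarrow> 'v::ab_group_add \<Rightarrow> 'v" +
  fixes X0 X1 :: "'v qn_space" and C :: real
  assumes C: "C \<ge> 1"
    and X0: "quasi_normed_const smul C X0"
    and X1: "quasi_normed_const smul C X1"
begin

abbreviation K :: "real \<Rightarrow> 'v \<Rightarrow> real" where
  "K t x \<equiv> K_functional t x X0 X1"

lemma subspaces: "subspace (vecs X0)" "subspace (vecs X1)"
  using X0 X1 by (auto simp: quasi_normed_const_def)

lemma zero_mem: "0 \<in> vecs X0" "0 \<in> vecs X1"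
  using subspaces subspace_0 by auto

lemma qnorm_nonneg:
  "x \<in> vecs X0 \<Longrightarrow> 0 \<le> qnorm X0 x" "x \<in> vecs X1 \<Longrightarrow> 0 \<le> qnorm X1 x"
  using X0 X1 by (auto simp: quasi_normed_const_def)

lemma qnorm_zero: "qnorm X0 0 = 0" "qnorm X1 0 = 0"
  using X0 X1 zero_mem by (auto simp: quasi_normed_const_def)

lemma qnorm_smul:
  "x \<in> vecs X0 \<Longrightarrow> qnorm X0 (smul c x) = norm c * qnorm X0 x"
  "x \<in> vecs X1 \<Longrightarrow> qnorm X1 (smul c x) = norm c * qnorm X1 x"
  using X0 X1 by (auto simp: quasi_normed_const_def)

lemma qnorm_add:
  "x \<in> vecs X0 \<Longrightarrow> y \<in> vecs X0 \<Longrightarrow> qnorm X0 (x + y) \<le> C * (qnorm X0 x + qnorm X0 y)"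
  "x \<in> vecs X1 \<Longrightarrow> y \<in> vecs X1 \<Longrightarrow> qnorm X1 (x + y) \<le> C * (qnorm X1 x + qnorm X1 y)"
  using X0 X1 by (auto simp: quasi_normed_const_def)

lemma vecs_sum_iff:
  "x \<in> vecs (couple_sum X0 X1) \<longleftrightarrow> (\<exists>x0\<in>vecs X0. \<exists>x1\<in>vecs X1. x = x0 + x1)"
  by (auto simp: couple_sum_def)

lemma vecs_le_sum: "vecs X0 \<subseteq> vecs (couple_sum X0 X1)" "vecs X1 \<subseteq> vecs (couple_sum X0 X1)"
  using zero_mem by (auto simp: vecs_sum_iff) (metis add.right_neutral, metis add.left_neutral)

lemma subspace_sum: "subspace (vecs (couple_sum X0 X1))"
  using subspace_sums[OF subspaces]
  by (auto simp: couple_sum_def)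

lemma qnorm_sum: "qnorm (couple_sum X0 X1) x = K 1 x"
  by (simp add: couple_sum_def K_functional_def)

section \<open>Estimates by decompositions\<close>

lemma K_le:
  assumes "0 \<le> t" "x0 \<in> vecs X0" "x1 \<in> vecs X1"
  shows "K t (x0 + x1) \<le> qnorm X0 x0 + t * qnorm X1 x1"
  unfolding K_functional_def
proof (rule cInf_lower)
  show "bdd_below {qnorm X0 x0' + t * qnorm X1 x1' |x0' x1'.
      x0' \<in> vecs X0 \<and> x1' \<in> vecs X1 \<and> x0 + x1 = x0' + x1'}"
    using assms(1) by (intro bdd_belowI[of _ 0]) (auto simp: qnorm_nonneg)
qed (use assms in blast)

lemma K_ge:
  assumes "x \<in> vecs (couple_sum X0 X1)"
    and "\<And>x0 x1. x0 \<in> vecs X0 \<Longrightarrow> x1 \<in> vecs X1 \<Longrightarrow> x = x0 + x1 \<Longrightarrow> z \<le> qnorm X0 x0 + t * qnorm X1 x1"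
  shows "z \<le> K t x"
  unfolding K_functional_def
  by (rule cInf_greatest) (use assms in \<open>auto simp: vecs_sum_iff\<close>)

lemma K_less_decomp:
  assumes "x \<in> vecs (couple_sum X0 X1)" "K t x < z"
  obtains x0 x1 where "x0 \<in> vecs X0" "x1 \<in> vecs X1" "x = x0 + x1"
    "qnorm X0 x0 + t * qnorm X1 x1 < z"
  using K_ge[OF assms(1), of z t] assms(2) by force

lemma K_nonneg: "x \<in> vecs (couple_sum X0 X1) \<Longrightarrow> 0 \<le> t \<Longrightarrow> 0 \<le> K t x"
  by (rule K_ge) (auto simp: qnorm_nonneg)

lemma K_mono:
  assumes "x \<in> vecs (couple_sum X0 X1)" "0 \<le> s" "s \<le> t"
  shows "K s x \<le> K t x"
proof (rule K_ge[OF assms(1)])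
  fix x0 x1 assume x: "x0 \<in> vecs X0" "x1 \<in> vecs X1" "x = x0 + x1"
  have "s * qnorm X1 x1 \<le> t * qnorm X1 x1"
    using x assms by (intro mult_right_mono qnorm_nonneg)
  with K_le[OF assms(2) x(1,2)] x(3) show "K s x \<le> qnorm X0 x0 + t * qnorm X1 x1" by simp
qed

text \<open>Both coefficients 1 and \<open>t\<close> are at least \<open>min 1 t\<close>, so every
  decomposition costs at least \<open>min 1 t\<close> times its cost at parameter 1.\<close>

lemma K_ge_min:
  assumes "x \<in> vecs (couple_sum X0 X1)" "0 \<le> t"
  shows "min 1 t * K 1 x \<le> K t x"
proof (rule K_ge[OF assms(1)])
  fix x0 x1 assume x: "x0 \<in> vecs X0" "x1 \<in> vecs X1" "x = x0 + x1"
  have "min 1 t * K 1 x \<le> min 1 t * (qnorm X0 x0 + qnorm X1 x1)"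
    using K_le[of 1 x0 x1] x assms(2) by (intro mult_left_mono) auto
  also have "\<dots> = min 1 t * qnorm X0 x0 + min 1 t * qnorm X1 x1" by (simp add: distrib_left)
  also have "\<dots> \<le> 1 * qnorm X0 x0 + t * qnorm X1 x1"
    using x by (intro add_mono mult_right_mono qnorm_nonneg) auto
  finally show "min 1 t * K 1 x \<le> qnorm X0 x0 + t * qnorm X1 x1" by simp
qed

text \<open>Use the trivial decompositions: \<open>0 + x\<close> for \<open>t \<le> 1\<close> and
  \<open>x + 0\<close> for \<open>t > 1\<close>.\<close>

lemma K_le_inter:
  assumes "x \<in> vecs X0" "x \<in> vecs X1" "0 \<le> t"
  shows "K t x \<le> min 1 t * max (qnorm X0 x) (qnorm X1 x)"
proof (cases "t \<le> 1")
  case True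
  have "K t x \<le> t * qnorm X1 x"
    using K_le[of t 0 x] assms zero_mem by (simp add: qnorm_zero)
  also have "\<dots> \<le> t * max (qnorm X0 x) (qnorm X1 x)"
    using assms by (intro mult_left_mono) auto
  finally show ?thesis using True by (simp add: min_def)
next
  case False
  then show ?thesis
    using K_le[of t x 0] assms zero_mem by (simp add: qnorm_zero min_def)
qed

lemma K_zero: "0 \<le> t \<Longrightarrow> K t 0 = 0"
  using K_le_inter[of 0 t] K_nonneg[of 0 t] zero_mem vecs_le_sum by (auto simp: qnorm_zero)

lemma K_add:
  assumes x: "x \<in> vecs (couple_sum X0 X1)" and y: "y \<in> vecs (couple_sum X0 X1)" and t: "0 \<le> t"
  shows "K t (x + y) \<le> C * (K t x + K t y)"
proof (rule field_le_epsilon)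
  fix e :: real assume "e > 0"
  \<comment> \<open>The infimum need not be attained, so both decompositions are taken optimal up to
    \<open>d\<close>; the total error \<open>C * (2 * d)\<close> is then \<open>e\<close>.\<close>
  define d where "d = e / (2 * C)"
  have d: "d > 0" "C * (2 * d) = e" using \<open>e > 0\<close> C by (auto simp: d_def)
  obtain x0 x1 where x': "x0 \<in> vecs X0" "x1 \<in> vecs X1" "x = x0 + x1"
    "qnorm X0 x0 + t * qnorm X1 x1 < K t x + d"
    by (rule K_less_decomp[OF x, of t "K t x + d"]) (use d in auto)
  obtain y0 y1 where y': "y0 \<in> vecs X0" "y1 \<in> vecs X1" "y = y0 + y1"
    "qnorm X0 y0 + t * qnorm X1 y1 < K t y + d"
    by (rule K_less_decomp[OF y, of t "K t y + d"]) (use d in auto)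
  have "K t (x + y) = K t ((x0 + y0) + (x1 + y1))"
    using x' y' by (simp add: algebra_simps)
  also have "\<dots> \<le> qnorm X0 (x0 + y0) + t * qnorm X1 (x1 + y1)"
    using x' y' t subspaces by (intro K_le subspace_add)
  also have "\<dots> \<le> C * (qnorm X0 x0 + qnorm X0 y0) + t * (C * (qnorm X1 x1 + qnorm X1 y1))"
    using x' y' t by (intro add_mono mult_left_mono qnorm_add)
  also have "\<dots> = C * ((qnorm X0 x0 + t * qnorm X1 x1) + (qnorm X0 y0 + t * qnorm X1 y1))"
    by (simp add: algebra_simps)
  also have "\<dots> \<le> C * ((K t x + d) + (K t y + d))"
    using x'(4) y'(4) C by (intro mult_left_mono) auto
  also have "\<dots> = C * (K t x + K t y) + e"
    using d by (simp add: algebra_simps)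
  finally show "K t (x + y) \<le> C * (K t x + K t y) + e" .
qed

text \<open>An additive \<open>T\<close> maps a near-optimal decomposition of \<open>x\<close> to a
  decomposition of \<open>T x\<close>. Applied to scalar multiplication, this also gives half of
  homogeneity.\<close>

lemma K_linear_le:
  assumes x: "x \<in> vecs (couple_sum X0 X1)" and t: "0 \<le> t" and M: "0 \<le> M"
    and T: "\<And>x y. x \<in> vecs (couple_sum X0 X1) \<Longrightarrow> y \<in> vecs (couple_sum X0 X1) \<Longrightarrow>
              T (x + y) = T x + T y"
    and T0: "\<And>x. x \<in> vecs X0 \<Longrightarrow> T x \<in> vecs X0 \<and> qnorm X0 (T x) \<le> M * qnorm X0 x"
    and T1: "\<And>x. x \<in> vecs X1 \<Longrightarrow> T x \<in> vecs X1 \<and> qnorm X1 (T x) \<le> M * qnorm X1 x"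
  shows "K t (T x) \<le> M * K t x"
proof (rule field_le_epsilon)
  fix e :: real assume "e > 0"
  \<comment> \<open>The summand 1 covers the case \<open>M = 0\<close>.\<close>
  define d where "d = e / (M + 1)"
  have d: "d > 0" "M * d \<le> e" using \<open>e > 0\<close> M by (auto simp: d_def field_simps)
  obtain x0 x1 where x': "x0 \<in> vecs X0" "x1 \<in> vecs X1" "x = x0 + x1"
    "qnorm X0 x0 + t * qnorm X1 x1 < K t x + d"
    by (rule K_less_decomp[OF x, of t "K t x + d"]) (use d in auto)
  have "K t (T x) = K t (T x0 + T x1)" using x' T[OF subsetD[OF vecs_le_sum(1)] subsetD[OF vecs_le_sum(2)]] by simp
  also have "\<dots> \<le> qnorm X0 (T x0) + t * qnorm X1 (T x1)"
    using x' T0 T1 t by (intro K_le) auto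
  also have "\<dots> \<le> M * qnorm X0 x0 + t * (M * qnorm X1 x1)"
    using x' T0 T1 t by (intro add_mono mult_left_mono) auto
  also have "\<dots> = M * (qnorm X0 x0 + t * qnorm X1 x1)" by (simp add: algebra_simps)
  also have "\<dots> \<le> M * (K t x + d)" using x' M by (intro mult_left_mono) auto
  also have "\<dots> \<le> M * K t x + e" using d by (simp add: algebra_simps)
  finally show "K t (T x) \<le> M * K t x + e" .
qed

lemma K_smul_le:
  assumes "x \<in> vecs (couple_sum X0 X1)" "0 \<le> t"
  shows "K t (smul c x) \<le> norm c * K t x"
  using assms subspaces
  by (intro K_linear_le[where T = "smul c"]) (auto simp: qnorm_smul scale_right_distrib intro: subspace_scale)

lemma K_smul:
  assumes "x \<in> vecs (couple_sum X0 X1)" "0 \<le> t"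
  shows "K t (smul c x) = norm c * K t x"
proof (cases "c = 0")
  case True
  then show ?thesis using assms by (simp add: K_zero)
next
  case False
  \<comment> \<open>The reverse inequality comes from the same bound applied to the inverse
    scalar.\<close>
  have "K t (smul (inverse c) (smul c x)) \<le> norm (inverse c) * K t (smul c x)"
    using assms subspace_sum by (intro K_smul_le) (auto intro: subspace_scale)
  from mult_left_mono[OF this, of "norm c"] have "norm c * K t x \<le> K t (smul c x)"
    using False by (simp add: norm_mult[symmetric] mult.assoc[symmetric] del: norm_inverse)
  with K_smul_le[OF assms, of c] show ?thesis by simp
qed

end

section \<open>Compatible couples, continuous embeddings and operator norms\<close>

lemma quasi_normed_const_mono:
  assumes "quasi_normed_const smul C X" "C \<le> D"
  shows "quasi_normed_const smul D X"
proof -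
  have "module.subspace smul (vecs X)"
    and nonneg: "\<And>x. x \<in> vecs X \<Longrightarrow> 0 \<le> qnorm X x"
    using assms(1) by (auto simp: quasi_normed_const_def)
  have "qnorm X (x + y) \<le> D * (qnorm X x + qnorm X y)" if "x \<in> vecs X" "y \<in> vecs X" for x y
  proof -
    have "qnorm X (x + y) \<le> C * (qnorm X x + qnorm X y)"
      using assms(1) that by (auto simp: quasi_normed_const_def)
    also have "\<dots> \<le> D * (qnorm X x + qnorm X y)"
      using that assms(2) nonneg by (intro mult_right_mono add_nonneg_nonneg)
    finally show ?thesis .
  qed
  with assms(1) show ?thesis by (auto simp: quasi_normed_const_def)
qed

lemma compatible_couple_vector_space: "compatible_couple smul X0 X1 \<Longrightarrow> vector_space smul"
  by (auto simp: compatible_couple_def Hausdorff_tvs_def)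

lemma compatible_couple_const:
  assumes "compatible_couple smul X0 X1"
  obtains C where "quasi_normed_couple smul X0 X1 C"
proof -
  from assms obtain C0 C1 where "C0 \<ge> 1" "quasi_normed_const smul C0 X0"
    "C1 \<ge> 1" "quasi_normed_const smul C1 X1"
    by (auto simp: compatible_couple_def quasi_normed_space_def)
  then have "quasi_normed_couple smul X0 X1 (max C0 C1)"
    using compatible_couple_vector_space[OF assms]
    by (auto simp: quasi_normed_couple_def quasi_normed_couple_axioms_def
        intro: quasi_normed_const_mono)
  then show ?thesis by (rule that)
qed

lemma openin_qn_topology_ball:
  assumes "continuously_embedded (qn_topology X) T" "openin T U" "0 \<in> U" "0 \<in> vecs X"
  obtains e where "e > 0" "\<And>y. y \<in> vecs X \<Longrightarrow> qnorm X y < e \<Longrightarrow> y \<in> U"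
proof -
  have "openin (qn_topology X) {x \<in> topspace (qn_topology X). x \<in> U}"
    using assms(1,2) by (auto simp: continuously_embedded_def continuous_map_def)
  moreover have "0 \<in> {x \<in> topspace (qn_topology X). x \<in> U}"
    using assms(3,4) by (simp add: topspace_qn_topology)
  ultimately obtain e where "e > 0"
    "\<forall>y\<in>vecs X. qnorm X (y - 0) < e \<longrightarrow> y \<in> {x \<in> topspace (qn_topology X). x \<in> U}"
    unfolding openin_qn_topology by blast
  then show ?thesis by (intro that[of e]) auto
qed

text \<open>Otherwise some neighbourhood \<open>V\<close> of 0 omits \<open>x\<close>. Continuity of
  addition at the origin gives neighbourhoods \<open>A\<close> and \<open>B\<close> of 0 whose sums
  lie in \<open>V\<close>. As the infimum is 0, \<open>x\<close> splits into pieces so small that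
  the embeddings put them in \<open>A\<close> and \<open>B\<close>, so \<open>x\<close> lies in
  \<open>V\<close>.\<close>

lemma K_eq_0_imp_eq_0:
  assumes comp: "compatible_couple smul X0 X1" and x: "x \<in> vecs (couple_sum X0 X1)"
    and K: "K_functional 1 x X0 X1 = 0"
  shows "x = 0"
proof (rule ccontr)
  assume "x \<noteq> 0"
  from compatible_couple_const[OF comp] obtain C where "quasi_normed_couple smul X0 X1 C" .
  then interpret quasi_normed_couple smul X0 X1 C .
  from comp obtain T where T: "Hausdorff_tvs smul T"
    and emb: "continuously_embedded (qn_topology X0) T" "continuously_embedded (qn_topology X1) T"
    by (auto simp: compatible_couple_def)
  have UNIV: "topspace T = UNIV" and Haus: "Hausdorff_space T"
    and cont: "continuous_map (prod_topology T T) T (\<lambda>(x, y). x + y)"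
    using T by (auto simp: Hausdorff_tvs_def)
  have "\<exists>U V. openin T U \<and> openin T V \<and> x \<in> U \<and> 0 \<in> V \<and> disjnt U V"
    using Haus \<open>x \<noteq> 0\<close> UNIV unfolding Hausdorff_space_def by simp
  then obtain V where V: "openin T V" "0 \<in> V" "x \<notin> V"
    by (auto simp: disjnt_iff)
  have "openin (prod_topology T T) {p. (\<lambda>(x, y). x + y) p \<in> V}"
    using cont V(1) UNIV by (simp add: continuous_map_def)
  moreover have "(0, 0) \<in> {p. (\<lambda>(x, y). x + y) p \<in> V}" using V(2) by simp
  ultimately have "\<exists>A B. openin T A \<and> openin T B \<and> 0 \<in> A \<and> 0 \<in> B \<and>
      A \<times> B \<subseteq> {p. (\<lambda>(x, y). x + y) p \<in> V}"
    unfolding openin_prod_topology_alt by blast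
  then obtain A B where AB: "openin T A" "openin T B" "0 \<in> A" "0 \<in> B"
    "A \<times> B \<subseteq> {p. (\<lambda>(x, y). x + y) p \<in> V}"
    by blast
  obtain e0 where e0: "e0 > 0" "\<And>y. y \<in> vecs X0 \<Longrightarrow> qnorm X0 y < e0 \<Longrightarrow> y \<in> A"
    using openin_qn_topology_ball[OF emb(1) AB(1,3) zero_mem(1)] by blast
  obtain e1 where e1: "e1 > 0" "\<And>y. y \<in> vecs X1 \<Longrightarrow> qnorm X1 y < e1 \<Longrightarrow> y \<in> B"
    using openin_qn_topology_ball[OF emb(2) AB(2,4) zero_mem(2)] by blast
  obtain x0 x1 where dec: "x0 \<in> vecs X0" "x1 \<in> vecs X1" "x = x0 + x1"
    "qnorm X0 x0 + 1 * qnorm X1 x1 < min e0 e1"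
    by (rule K_less_decomp[OF x, of 1 "min e0 e1"]) (use K e0 e1 in auto)
  then have "x0 \<in> A" "x1 \<in> B"
    using qnorm_nonneg(1)[of x0] qnorm_nonneg(2)[of x1] e0(2)[of x0] e1(2)[of x1] by auto
  with AB(5) dec(3) V(3) show False by auto
qed

text \<open>A linear bound suffices even though balls need not be open, because openness in
  \<open>qn_topology\<close> asks only for a ball around each point. The subspace property makes the
  bound applicable to differences.\<close>

lemma continuously_embedded_qn:
  assumes sub: "module.subspace smul (vecs A)" and vs: "vector_space smul"
    and "vecs A \<subseteq> vecs B" and c: "0 \<le> c" "\<And>x. x \<in> vecs A \<Longrightarrow> qnorm B x \<le> c * qnorm A x"
  shows "continuously_embedded (qn_topology A) (qn_topology B)"
proof -
  interpret vector_space smul by (rule vs)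
  have "openin (qn_topology A) {x \<in> vecs A. x \<in> U}" if U: "openin (qn_topology B) U" for U
    unfolding openin_qn_topology
  proof (intro conjI ballI)
    fix x assume x: "x \<in> {x \<in> vecs A. x \<in> U}"
    with U obtain e where e: "e > 0" "\<And>y. y \<in> vecs B \<Longrightarrow> qnorm B (y - x) < e \<Longrightarrow> y \<in> U"
      unfolding openin_qn_topology by blast
    show "\<exists>e>0. \<forall>y\<in>vecs A. qnorm A (y - x) < e \<longrightarrow> y \<in> {x \<in> vecs A. x \<in> U}"
    \<comment> \<open>The summand 1 makes the radius meaningful for \<open>c = 0\<close> and keeps
      the final inequality strict.\<close>
    proof (intro exI[of _ "e / (c + 1)"] conjI ballI impI)
      fix y assume y: "y \<in> vecs A" and lt: "qnorm A (y - x) < e / (c + 1)"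
      have "y - x \<in> vecs A" using x y sub subspace_diff by blast
      then have "qnorm B (y - x) \<le> c * qnorm A (y - x)" by (rule c(2))
      also have "\<dots> \<le> c * (e / (c + 1))" using lt c(1) by (intro mult_left_mono) auto
      also have "\<dots> < e" using e(1) c(1) by (simp add: field_simps)
      finally show "y \<in> {x \<in> vecs A. x \<in> U}" using e(2) y assms(3) by auto
    qed (use e c in auto)
  qed auto
  then show ?thesis
    using assms(3) by (auto simp: continuously_embedded_def continuous_map_def topspace_qn_topology)
qed


text \<open>The infimum defining \<open>op_norm\<close> is itself an admissible bound: for non-zero
  quasi-norm, divide by it; for zero quasi-norm, any bound already forces the image to have
  quasi-norm at most 0.\<close>

lemma op_norm_nonneg: "bounded_op X T \<Longrightarrow> (\<And>x. x \<in> vecs X \<Longrightarrow> 0 \<le> qnorm X x) \<Longrightarrow> 0 \<le> op_norm X T"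
  and op_norm_bound:
    "bounded_op X T \<Longrightarrow> (\<And>x. x \<in> vecs X \<Longrightarrow> 0 \<le> qnorm X x) \<Longrightarrow> x \<in> vecs X \<Longrightarrow>
       qnorm X (T x) \<le> op_norm X T * qnorm X x"
proof -
  let ?S = "{C. 0 \<le> C \<and> (\<forall>x\<in>vecs X. qnorm X (T x) \<le> C * qnorm X x)}"
  assume bdd: "bounded_op X T" and nonneg: "\<And>x. x \<in> vecs X \<Longrightarrow> 0 \<le> qnorm X x"
  from bdd obtain C where C: "\<And>x. x \<in> vecs X \<Longrightarrow> qnorm X (T x) \<le> C * qnorm X x"
    by (auto simp: bounded_op_def)
  have "qnorm X (T x) \<le> max C 0 * qnorm X x" if "x \<in> vecs X" for x
    using C[OF that] nonneg[OF that] by (smt (verit) mult_right_mono)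
  then have ne: "?S \<noteq> {}" by (auto intro!: exI[of _ "max C 0"])
  then show "0 \<le> op_norm X T"
    unfolding op_norm_def by (intro cInf_greatest) auto
  assume x: "x \<in> vecs X"
  show "qnorm X (T x) \<le> op_norm X T * qnorm X x"
  proof (cases "qnorm X x = 0")
    case True
    then show ?thesis using C[OF x] by simp
  next
    case False
    then have pos: "qnorm X x > 0" using nonneg[OF x] by simp
    have "qnorm X (T x) / qnorm X x \<le> op_norm X T"
      unfolding op_norm_def using ne x pos by (intro cInf_greatest) (auto simp: divide_le_eq)
    with pos show ?thesis by (simp add: divide_le_eq)
  qed
qed

lemma op_norm_le:
  assumes "0 \<le> M" "\<And>x. x \<in> vecs X \<Longrightarrow> qnorm X (T x) \<le> M * qnorm X x"
  shows "op_norm X T \<le> M"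
  unfolding op_norm_def using assms by (intro cInf_lower bdd_belowI[of _ 0]) auto

section \<open>The interpolation space\<close>

text \<open>From here on the Boyd indices are present only through
  \<open>weight_finite\<close>.\<close>

locale interpolation_couple =
  ri_quasi_Banach_space L \<rho> + quasi_normed_couple smul X0 X1 C
  for L :: ereal and \<rho> :: "(real \<Rightarrow> complex) \<Rightarrow> ennreal"
    and smul :: "'k::real_normed_field \<Rightarrow> 'v::ab_group_add \<Rightarrow> 'v"
    and X0 X1 :: "'v qn_space" and C :: real +
  fixes \<Theta> r :: real
  assumes \<Theta>: "0 < \<Theta>"
    and weight_finite: "R (\<lambda>t. t powr (- 1 / r) * min 1 (t powr (1 / \<Theta>))) < \<infinity>"
begin

abbreviation weight :: "real \<Rightarrow> real" where
  "weight t \<equiv> t powr (- 1 / r) * min 1 (t powr (1 / \<Theta>))"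

abbreviation V :: "'v \<Rightarrow> ennreal" where
  "V \<equiv> interp_value \<Theta> r \<rho> X0 X1"

abbreviation X :: "'v qn_space" where
  "X \<equiv> interp_space \<Theta> r \<rho> X0 X1"

definition weighted_K :: "'v \<Rightarrow> real \<Rightarrow> real" where
  "weighted_K x t = t powr (- 1 / r) * K (t powr (1 / \<Theta>)) x"

section \<open>Estimates for the interpolation functional\<close>

lemma V_eq: "V x = R (weighted_K x)"
  by (simp add: interp_value_def weighted_K_def)

lemma weight_measurable: "weight \<in> borel_measurable (leb L)"
  using powr_measurable by simp

lemma weighted_K_measurable:
  assumes "x \<in> vecs (couple_sum X0 X1)"
  shows "weighted_K x \<in> borel_measurable (leb L)"
proof -
  \<comment> \<open>Measurability comes from monotonicity of the K-functional in its
    parameter.\<close>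
  have "(\<lambda>t. K (t powr (1 / \<Theta>)) x) \<in> borel_measurable (leb L)"
    using assms \<Theta> by (intro mono_on_measurable_leb mono_onI K_mono powr_mono2) auto
  then show ?thesis unfolding weighted_K_def using powr_measurable by simp
qed

lemma weighted_K_nonneg: "x \<in> vecs (couple_sum X0 X1) \<Longrightarrow> 0 \<le> weighted_K x t"
  by (simp add: weighted_K_def K_nonneg)

lemma V_le_inter:
  assumes "x \<in> vecs X0" "x \<in> vecs X1"
  shows "V x \<le> ennreal (max (qnorm X0 x) (qnorm X1 x)) * R weight"
proof -
  let ?m = "max (qnorm X0 x) (qnorm X1 x)"
  have m: "0 \<le> ?m" using qnorm_nonneg(1)[OF assms(1)] by simp
  have sum: "x \<in> vecs (couple_sum X0 X1)" using assms vecs_le_sum by auto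
  have "R (weighted_K x) \<le> R (\<lambda>t. ?m * weight t)"
  proof (rule R_mono)
    fix t
    have "weighted_K x t \<le> t powr (- 1 / r) * (min 1 (t powr (1 / \<Theta>)) * ?m)"
      unfolding weighted_K_def using assms by (intro mult_left_mono K_le_inter) auto
    then show "0 \<le> weighted_K x t \<and> weighted_K x t \<le> ?m * weight t"
      using weighted_K_nonneg[OF sum] by (simp add: mult_ac)
  qed (use weight_measurable weighted_K_measurable[OF sum] in simp_all)
  then show ?thesis using R_scale[OF weight_measurable m] by (simp add: V_eq)
qed

lemma V_ge:
  assumes "x \<in> vecs (couple_sum X0 X1)"
  shows "ennreal (K 1 x) * R weight \<le> V x"
proof -
  have K: "0 \<le> K 1 x" using assms by (intro K_nonneg) auto
  have "R (\<lambda>t. K 1 x * weight t) \<le> R (weighted_K x)"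
  proof (rule R_mono)
    fix t
    have "t powr (- 1 / r) * (min 1 (t powr (1 / \<Theta>)) * K 1 x) \<le> weighted_K x t"
      unfolding weighted_K_def using assms by (intro mult_left_mono K_ge_min) auto
    then show "0 \<le> K 1 x * weight t \<and> K 1 x * weight t \<le> weighted_K x t"
      using K by (simp add: mult_ac)
  qed (use weight_measurable weighted_K_measurable[OF assms] in simp_all)
  then show ?thesis using R_scale[OF weight_measurable K] by (simp add: V_eq)
qed

text \<open>The two quasi-triangle constants multiply: \<open>C\<close> comes from the couple
  through the K-functional and \<open>D\<close> from \<rho>.\<close>

lemma V_add:
  assumes D: "ext_triangle_const L \<rho> D"
    and x: "x \<in> vecs (couple_sum X0 X1)" and y: "y \<in> vecs (couple_sum X0 X1)"
  shows "V (x + y) \<le> ennreal C * (ennreal D * (V x + V y))"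
proof -
  have xy: "x + y \<in> vecs (couple_sum X0 X1)" using subspace_sum x y by (rule subspace_add)
  note meas = weighted_K_measurable[OF x] weighted_K_measurable[OF y]
  have "R (weighted_K (x + y)) \<le> R (\<lambda>t. C * (weighted_K x t + weighted_K y t))"
  proof (rule R_mono)
    fix t
    have "weighted_K (x + y) t
        \<le> t powr (- 1 / r) * (C * (K (t powr (1 / \<Theta>)) x + K (t powr (1 / \<Theta>)) y))"
      unfolding weighted_K_def using x y by (intro mult_left_mono K_add) auto
    then show "0 \<le> weighted_K (x + y) t \<and>
        weighted_K (x + y) t \<le> C * (weighted_K x t + weighted_K y t)"
      using weighted_K_nonneg[OF xy] by (simp add: weighted_K_def algebra_simps)
  qed (use meas weighted_K_measurable[OF xy] in simp_all)
  also have "\<dots> = ennreal C * R (\<lambda>t. weighted_K x t + weighted_K y t)"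
    using meas C by (intro R_scale) auto
  also have "\<dots> \<le> ennreal C * (ennreal D * (R (weighted_K x) + R (weighted_K y)))"
    using meas by (intro mult_left_mono R_triangle[OF D]) auto
  finally show ?thesis by (simp add: V_eq)
qed

lemma V_le_scale:
  assumes x: "x \<in> vecs (couple_sum X0 X1)" and y: "y \<in> vecs (couple_sum X0 X1)" and M: "0 \<le> M"
    and le: "\<And>t. 0 \<le> t \<Longrightarrow> K t y \<le> M * K t x"
  shows "V y \<le> ennreal M * V x"
proof -
  have "R (weighted_K y) \<le> R (\<lambda>t. M * weighted_K x t)"
  proof (rule R_mono)
    fix t
    have "weighted_K y t \<le> t powr (- 1 / r) * (M * K (t powr (1 / \<Theta>)) x)"
      unfolding weighted_K_def by (intro mult_left_mono le) auto
    then show "0 \<le> weighted_K y t \<and> weighted_K y t \<le> M * weighted_K x t"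
      using weighted_K_nonneg[OF y] by (simp add: weighted_K_def mult_ac)
  qed (use weighted_K_measurable[OF x] weighted_K_measurable[OF y] in simp_all)
  then show ?thesis using R_scale[OF weighted_K_measurable[OF x] M] by (simp add: V_eq)
qed

lemma V_smul:
  assumes x: "x \<in> vecs (couple_sum X0 X1)"
  shows "V (smul c x) = ennreal (norm c) * V x"
proof -
  have "weighted_K (smul c x) = (\<lambda>t. norm c * weighted_K x t)"
    using K_smul[OF x] by (auto simp: weighted_K_def)
  then show ?thesis using R_scale[OF weighted_K_measurable[OF x]] by (simp add: V_eq)
qed

lemma V_zero: "V 0 = 0"
  using V_le_inter[OF zero_mem] by (simp add: qnorm_zero)

section \<open>The interpolation space: embeddings, quasi-norm and operators\<close>

lemma vecs_interp: "x \<in> vecs X \<longleftrightarrow> x \<in> vecs (couple_sum X0 X1) \<and> V x < \<infinity>"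
  by (simp add: interp_space_def)

lemma qnorm_interp: "qnorm X x = enn2real (V x)"
  by (simp add: interp_space_def)

lemma V_interp: "x \<in> vecs X \<Longrightarrow> V x = ennreal (qnorm X x)"
  by (simp add: vecs_interp qnorm_interp)

lemma qnorm_interp_nonneg: "0 \<le> qnorm X x"
  by (simp add: qnorm_interp)

lemma qnorm_interp_leI:
  assumes "V x \<le> ennreal a" "0 \<le> a"
  shows "qnorm X x \<le> a"
  using enn2real_mono[OF assms(1)] assms(2) by (simp add: qnorm_interp)

lemma weight_real:
  obtains w where "0 < w" "R weight = ennreal w"
proof (rule that)
  show "0 < enn2real (R weight)" "R weight = ennreal (enn2real (R weight))"
    using weight_finite R_weight_nonzero[of r \<Theta>]
    by (simp_all add: enn2real_positive_iff pos2 zero_less_iff_neq_zero)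
qed

lemma inter_subset_interp: "vecs (couple_inter X0 X1) \<subseteq> vecs X"
proof
  fix x assume "x \<in> vecs (couple_inter X0 X1)"
  then have x: "x \<in> vecs X0" "x \<in> vecs X1" by (auto simp: couple_inter_def)
  note V_le_inter[OF x]
  also have "ennreal (max (qnorm X0 x) (qnorm X1 x)) * R weight < \<infinity>"
    using weight_finite by (simp add: ennreal_mult_less_top)
  finally show "x \<in> vecs X" using x vecs_le_sum by (auto simp: vecs_interp)
qed

lemma qnorm_interp_le_inter:
  assumes w: "0 < w" "R weight = ennreal w" and x: "x \<in> vecs (couple_inter X0 X1)"
  shows "qnorm X x \<le> w * qnorm (couple_inter X0 X1) x"
proof (rule qnorm_interp_leI)
  have x': "x \<in> vecs X0" "x \<in> vecs X1" using x by (auto simp: couple_inter_def)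
  then have nonneg: "0 \<le> max (qnorm X0 x) (qnorm X1 x)" using qnorm_nonneg(1)[of x] by auto
  show "V x \<le> ennreal (w * qnorm (couple_inter X0 X1) x)"
    using V_le_inter[OF x'] w nonneg
    by (simp add: couple_inter_def ennreal_mult'[symmetric] mult.commute)
  show "0 \<le> w * qnorm (couple_inter X0 X1) x" using w nonneg by (simp add: couple_inter_def)
qed

lemma qnorm_sum_le_interp:
  assumes w: "0 < w" "R weight = ennreal w" and x: "x \<in> vecs X"
  shows "qnorm (couple_sum X0 X1) x \<le> 1 / w * qnorm X x"
proof -
  have sum: "x \<in> vecs (couple_sum X0 X1)" using x by (simp add: vecs_interp)
  have "ennreal (K 1 x * w) \<le> ennreal (qnorm X x)"
    using V_ge[OF sum] w V_interp[OF x] K_nonneg[OF sum, of 1] by (simp add: ennreal_mult)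
  then have "K 1 x * w \<le> qnorm X x" by (simp add: qnorm_interp_nonneg)
  then show ?thesis using w by (simp add: qnorm_sum field_simps)
qed

lemma subspace_interp: "subspace (vecs X)"
proof -
  obtain D where D: "ext_triangle_const L \<rho> D"
    using ext_quasi_norms(1) by (auto simp: ext_quasi_norm_def)
  have "V (x + y) < \<infinity>" if "x \<in> vecs X" "y \<in> vecs X" for x y
  proof -
    have "V (x + y) \<le> ennreal C * (ennreal D * (V x + V y))"
      using that by (intro V_add[OF D]) (simp_all add: vecs_interp)
    also have "\<dots> < \<infinity>" using that by (simp add: ennreal_mult_less_top vecs_interp)
    finally show ?thesis .
  qed
  moreover have "V (smul c x) < \<infinity>" if "x \<in> vecs X" for x c
    using that V_smul[of x c] by (simp add: ennreal_mult_less_top vecs_interp)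
  moreover have "V 0 < \<infinity>" by (simp add: V_zero)
  ultimately show ?thesis
    using subspace_sum by (auto simp: subspace_def vecs_interp)
qed

text \<open>Definiteness is inherited from the sum: quasi-norm 0 forces \<open>K 1 x = 0\<close>,
  and then compatibility gives \<open>x = 0\<close>. The explicit constant \<open>C * D\<close>
  covers the normed case as well.\<close>

lemma quasi_normed_const_interp:
  assumes comp: "compatible_couple smul X0 X1"
    and D: "ext_triangle_const L \<rho> D" "0 \<le> D"
  shows "quasi_normed_const smul (C * D) X"
  unfolding quasi_normed_const_def
proof (intro conjI ballI allI)
  show "subspace (vecs X)" by (rule subspace_interp)
next
  fix x assume x: "x \<in> vecs X"
  then have sum: "x \<in> vecs (couple_sum X0 X1)" by (simp add: vecs_interp)
  show "0 \<le> qnorm X x" by (rule qnorm_interp_nonneg)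
  obtain w where w: "0 < w" "R weight = ennreal w" by (rule weight_real)
  show "qnorm X x = 0 \<longleftrightarrow> x = 0"
  proof
    assume "qnorm X x = 0"
    then have "K 1 x \<le> 0" using qnorm_sum_le_interp[OF w x] by (simp add: qnorm_sum)
    then have "K 1 x = 0" using K_nonneg[OF sum, of 1] by simp
    then show "x = 0" using K_eq_0_imp_eq_0[OF comp sum] by simp
  next
    assume "x = 0"
    then show "qnorm X x = 0" by (simp add: qnorm_interp V_zero)
  qed
  fix y assume y: "y \<in> vecs X"
  show "qnorm X (x + y) \<le> C * D * (qnorm X x + qnorm X y)"
  proof (rule qnorm_interp_leI)
    have "V (x + y) \<le> ennreal C * (ennreal D * (V x + V y))"
      using x y by (intro V_add D) (simp_all add: vecs_interp)
    also have "\<dots> = ennreal (C * D * (qnorm X x + qnorm X y))"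
      using C D qnorm_interp_nonneg
      by (simp add: V_interp[OF x] V_interp[OF y] ennreal_mult' mult.assoc flip: ennreal_plus)
    finally show "V (x + y) \<le> ennreal (C * D * (qnorm X x + qnorm X y))" .
    show "0 \<le> C * D * (qnorm X x + qnorm X y)" using C D qnorm_interp_nonneg by simp
  qed
next
  fix c x assume "x \<in> vecs X"
  then show "qnorm X (smul c x) = norm c * qnorm X x"
    by (simp add: qnorm_interp vecs_interp V_smul enn2real_mult)
qed

text \<open>The K-functional of \<open>T x\<close> is bounded with the same \<open>M\<close> at
  every parameter, and \<rho> is monotone and homogeneous. No quasi-triangle constant appears, which
  is why the interpolation is exact.\<close>

lemma qnorm_interp_linear_le:
  assumes lin: "linear_op_on smul (vecs (couple_sum X0 X1)) T"
    and bdd: "bounded_op X0 T" "bounded_op X1 T" and x: "x \<in> vecs X"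
  defines "M \<equiv> max (op_norm X0 T) (op_norm X1 T)"
  shows "T x \<in> vecs X" "qnorm X (T x) \<le> M * qnorm X x"
proof -
  have sum: "x \<in> vecs (couple_sum X0 X1)" using x by (simp add: vecs_interp)
  then have Tsum: "T x \<in> vecs (couple_sum X0 X1)" using lin by (auto simp: linear_op_on_def)
  have M: "0 \<le> M"
    unfolding M_def using op_norm_nonneg[OF bdd(1) qnorm_nonneg(1)] by simp
  have T0: "T y \<in> vecs X0 \<and> qnorm X0 (T y) \<le> M * qnorm X0 y" if y: "y \<in> vecs X0" for y
  proof
    show "T y \<in> vecs X0" using bdd(1) y by (auto simp: bounded_op_def)
    have "qnorm X0 (T y) \<le> op_norm X0 T * qnorm X0 y"
      using bdd(1) qnorm_nonneg(1) y by (rule op_norm_bound)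
    also have "\<dots> \<le> M * qnorm X0 y"
      unfolding M_def using qnorm_nonneg(1)[OF y] by (intro mult_right_mono) auto
    finally show "qnorm X0 (T y) \<le> M * qnorm X0 y" .
  qed
  have T1: "T y \<in> vecs X1 \<and> qnorm X1 (T y) \<le> M * qnorm X1 y" if y: "y \<in> vecs X1" for y
  proof
    show "T y \<in> vecs X1" using bdd(2) y by (auto simp: bounded_op_def)
    have "qnorm X1 (T y) \<le> op_norm X1 T * qnorm X1 y"
      using bdd(2) qnorm_nonneg(2) y by (rule op_norm_bound)
    also have "\<dots> \<le> M * qnorm X1 y"
      unfolding M_def using qnorm_nonneg(2)[OF y] by (intro mult_right_mono) auto
    finally show "qnorm X1 (T y) \<le> M * qnorm X1 y" .
  qed
  have "V (T x) \<le> ennreal M * V x"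
  proof (rule V_le_scale[OF sum Tsum M])
    fix t :: real assume "0 \<le> t"
    then show "K t (T x) \<le> M * K t x"
      using lin by (intro K_linear_le[OF sum _ M _ T0 T1]) (auto simp: linear_op_on_def)
  qed
  then have le: "V (T x) \<le> ennreal (M * qnorm X x)"
    using M by (simp add: V_interp[OF x] ennreal_mult')
  then show "T x \<in> vecs X" using Tsum by (auto simp: vecs_interp intro: le_less_trans)
  show "qnorm X (T x) \<le> M * qnorm X x"
    using le by (rule qnorm_interp_leI) (simp add: M qnorm_interp_nonneg)
qed

lemma subspace_inter_couple: "subspace (vecs (couple_inter X0 X1))"
  using subspaces by (simp add: couple_inter_def subspace_inter)

lemma exact_interpolation:
  "continuously_embedded (qn_topology (couple_inter X0 X1)) (qn_topology X)"
  "continuously_embedded (qn_topology X) (qn_topology (couple_sum X0 X1))"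
  "linear_op_on smul (vecs (couple_sum X0 X1)) T \<Longrightarrow> bounded_op X0 T \<Longrightarrow> bounded_op X1 T \<Longrightarrow>
     bounded_op X T \<and> op_norm X T \<le> max (op_norm X0 T) (op_norm X1 T)"
proof -
  obtain w where w: "0 < w" "R weight = ennreal w" by (rule weight_real)
  show "continuously_embedded (qn_topology (couple_inter X0 X1)) (qn_topology X)"
    using subspace_inter_couple vector_space_axioms inter_subset_interp less_imp_le[OF w(1)]
      qnorm_interp_le_inter[OF w]
    by (rule continuously_embedded_qn)
  show "continuously_embedded (qn_topology X) (qn_topology (couple_sum X0 X1))"
    using subspace_interp vector_space_axioms _ _ qnorm_sum_le_interp[OF w]
    by (rule continuously_embedded_qn) (use w in \<open>auto simp: vecs_interp\<close>)
  assume T: "linear_op_on smul (vecs (couple_sum X0 X1)) T" "bounded_op X0 T" "bounded_op X1 T"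
  have "0 \<le> op_norm X0 T" using T(2) qnorm_nonneg(1) by (rule op_norm_nonneg)
  then have "op_norm X T \<le> max (op_norm X0 T) (op_norm X1 T)"
    using qnorm_interp_linear_le(2)[OF T] by (intro op_norm_le) auto
  moreover have "bounded_op X T"
    unfolding bounded_op_def using qnorm_interp_linear_le[OF T] by blast
  ultimately show "bounded_op X T \<and> op_norm X T \<le> max (op_norm X0 T) (op_norm X1 T)" by simp
qed

end

theorem theorem14:
  fixes L :: ereal
    and \<rho> :: "(real \<Rightarrow> complex) \<Rightarrow> ennreal"
    and \<Theta> r :: real
    and smul :: "'k::real_normed_field \<Rightarrow> 'v::ab_group_add \<Rightarrow> 'v"
  assumes "L \<in> {1, \<infinity>}"
    and "ri_quasi_Banach L \<rho>"
    and "0 < \<Theta>"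
    and "0 < r" and "ennreal r < lower_Boyd L \<rho>"
    and "upper_Boyd L \<rho> < \<infinity> \<Longrightarrow> 1 / \<Theta> + 1 / enn2real (upper_Boyd L \<rho>) > 1 / r"
    and "upper_Boyd L \<rho> = \<infinity> \<Longrightarrow> 1 / \<Theta> \<ge> 1 / r"
  shows "exact_interpolation_functor smul (interp_space \<Theta> r \<rho>)
    \<and> (\<forall>X0 X1. compatible_couple smul X0 X1 \<longrightarrow>
          quasi_normed_space smul (interp_space \<Theta> r \<rho> X0 X1))
    \<and> (\<forall>X0 X1. compatible_couple smul X0 X1 \<and>
          normed_space smul X0 \<and> normed_space smul X1 \<and> ext_triangle_const L \<rho> 1 \<longrightarrow>
          normed_space smul (interp_space \<Theta> r \<rho> X0 X1))"
proof -
  interpret ri_quasi_Banach_space L \<rho>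
    using assms(1,2) by unfold_locales auto
  have couple: "interpolation_couple L \<rho> smul X0 X1 C \<Theta> r"
    if "quasi_normed_couple smul X0 X1 C" for X0 X1 :: "'v qn_space" and C
    using that R_weight_finite[OF assms(3-7)] assms(3) ri_quasi_Banach_space_axioms
    by (simp add: interpolation_couple_def interpolation_couple_axioms_def)
  have "exact_interpolation_functor smul (interp_space \<Theta> r \<rho>)"
    unfolding exact_interpolation_functor_def
  proof (intro allI impI)
    fix X0 X1 :: "'v qn_space" assume "compatible_couple smul X0 X1"
    then obtain C where "quasi_normed_couple smul X0 X1 C" by (rule compatible_couple_const)
    then interpret interpolation_couple L \<rho> smul X0 X1 C \<Theta> r by (rule couple)
    show "continuously_embedded (qn_topology (couple_inter X0 X1)) (qn_topology X) \<and>
      continuously_embedded (qn_topology X) (qn_topology (couple_sum X0 X1)) \<and>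
      (\<forall>T. linear_op_on smul (vecs (couple_sum X0 X1)) T \<and> bounded_op X0 T \<and> bounded_op X1 T \<longrightarrow>
         bounded_op X T \<and> op_norm X T \<le> max (op_norm X0 T) (op_norm X1 T))"
      using exact_interpolation by blast
  qed
  moreover have "quasi_normed_space smul (interp_space \<Theta> r \<rho> X0 X1)"
    if comp: "compatible_couple smul X0 X1" for X0 X1 :: "'v qn_space"
  proof -
    from comp obtain C where couple_C: "quasi_normed_couple smul X0 X1 C"
      by (rule compatible_couple_const)
    interpret interpolation_couple L \<rho> smul X0 X1 C \<Theta> r by (rule couple[OF couple_C])
    obtain D where D: "D \<ge> 1" "ext_triangle_const L \<rho> D"
      using ext_quasi_norms(1) by (auto simp: ext_quasi_norm_def)
    have "quasi_normed_const smul (C * D) X"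
      using D by (intro quasi_normed_const_interp[OF comp]) auto
    moreover have "1 * 1 \<le> C * D"
      using D C by (intro mult_mono) auto
    ultimately show ?thesis
      unfolding quasi_normed_space_def by (intro exI[of _ "C * D"]) simp
  qed
  moreover have "normed_space smul (interp_space \<Theta> r \<rho> X0 X1)"
    if comp: "compatible_couple smul X0 X1" and normed: "normed_space smul X0" "normed_space smul X1"
      and E: "ext_triangle_const L \<rho> 1" for X0 X1 :: "'v qn_space"
  proof -
    \<comment> \<open>The couple is instantiated with constant 1, so with \<open>D = 1\<close> the
      interpolation space also has constant 1.\<close>
    have "quasi_normed_couple smul X0 X1 1"
      using normed compatible_couple_vector_space[OF comp]
      by (simp add: normed_space_def quasi_normed_couple_def quasi_normed_couple_axioms_def)
    then interpret interpolation_couple L \<rho> smul X0 X1 1 \<Theta> r by (rule couple)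
    show ?thesis
      using quasi_normed_const_interp[OF comp E] by (simp add: normed_space_def)
  qed
  ultimately show ?thesis by blast
qed

end
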